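(* Let $\dot x=Ax+Bu$, $y=Cx$ with $x\in\mathbb{R}^n$, $u\in\mathbb{R}^m$, $y\in\mathbb{R}^l$ be a left-invertible linear system. Then the system is output-input stable if and only if all its transmission zeros have negative real parts.
   Context: Left-invertible is understood in the standard sense: the transfer matrix $C(sI-A)^{-1}B$ has rank $m$ over the field of rational functions (equivalently, with zero initial state the map from inputs to outputs is injective). Transmission zeros: a subspace $\mathcal{V}\subset\mathbb{R}^n$ is $(A,B)$-invariant if there is an $m\times n$ matrix $F$ with $(A+BF)\mathcal{V}\subset\mathcal{V}$. Let $\mathcal{S}$ be the unique largest (with respect to inclusion) $(A,B)$-invariant subspace contained in $\ker C$. The eigenvalues of the restriction of $A+BF$ to $\mathcal{S}$ are the same for all $F$ such that $(A+BF)\mathcal{S}\subset\mathcal{S}$; these eigenvalues are the transmission zeros of the system. Notation: $|\cdot|$ is the Euclidean norm, $\|z\|_{[a,b]}$ is the essential supremum of $|z(s)|$ over $[a,b]$. For an $\mathbb{R}^l$-valued signal $y$, $\mathbf{y}^N:=(y_1;\dot y_1;\dots;y_1^{(N)};\dots;y_l;\dot y_l;\dots;y_l^{(N)})$. Class $\mathcal{K}$: continuous strictly increasing $\alpha:[0,\infty)\to[0,\infty)$ with $\alpha(0)=0$; class $\mathcal{K}_\infty$: unbounded class $\mathcal{K}$ functions; class $\mathcal{KL}$: $\beta:[0,\infty)^2\to[0,\infty)$ with $\beta(\cdot,t)\in\mathcal{K}$ for each $t$ and $\beta(s,t)$ decreasing to $0$ as $t\to\infty$ for each $s$. Output-input stability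 of a system $\dot x=f(x,u)$, $y=h(x)$ (here $f(x,u)=Ax+Bu$, $h(x)=Cx$): there exist a positive integer $N$, $\beta\in\mathcal{KL}$ and $\gamma\in\mathcal{K}_\infty$ such that for every initial state $x(0)$ and every $N-1$ times continuously differentiable input $u:[0,\infty)\to\mathbb{R}^m$, $$\left|\begin{pmatrix}u(t)\\ x(t)\end{pmatrix}\right|\le\beta(|x(0)|,t)+\gamma(\|\mathbf{y}^N\|_{[0,t]})$$ for all $t$ in the domain of the corresponding solution. *)

theory Defs
  imports
    "HOL-Analysis.Analysis"
    "HOL-Computational_Algebra.Fraction_Field"
    "HOL-Computational_Algebra.Polynomial"
    "HOL-Probability.Essential_Supremum"
begin

section \<open>Left-invertibility\<close>

text \<open>The field of rational functions in \<open>s\<close> is \<^typ>\<open>real poly fract\<close>; \<open>[:0, 1:]\<close> is \<open>s\<close> and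
  \<open>[:c:]\<close> is the constant \<open>c\<close>.\<close>

definition ratfun_s :: "real poly fract" where
  "ratfun_s = Fraction_Field.Fract [:0, 1:] 1"

definition ratfun_const :: "real \<Rightarrow> real poly fract" where
  "ratfun_const c = Fraction_Field.Fract [:c:] 1"

definition transfer_matrix ::
    "real^'n^'n \<Rightarrow> real^'m^'n \<Rightarrow> real^'n^'l \<Rightarrow> (real poly fract)^'m^'l" where
  "transfer_matrix A B C =
     map_matrix ratfun_const C ** matrix_inv (mat ratfun_s - map_matrix ratfun_const A)
       ** map_matrix ratfun_const B"

definition left_invertible :: "real^'n^'n \<Rightarrow> real^'m^'n \<Rightarrow> real^'n^'l \<Rightarrow> bool" where
  "left_invertible A B C \<longleftrightarrow> rank (transfer_matrix A B C) = CARD('m)"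


section \<open>Transmission zeros\<close>

definition AB_invariant :: "real^'n^'n \<Rightarrow> real^'m^'n \<Rightarrow> (real^'n) set \<Rightarrow> bool" where
  "AB_invariant A B V \<longleftrightarrow>
     subspace V \<and> (\<exists>F :: real^'n^'m. (*v) (A + B ** F) ` V \<subseteq> V)"

definition max_AB_invariant_in_ker ::
    "real^'n^'n \<Rightarrow> real^'m^'n \<Rightarrow> real^'n^'l \<Rightarrow> (real^'n) set" where
  "max_AB_invariant_in_ker A B C = (GREATEST V. AB_invariant A B V \<and> V \<subseteq> {x. C *v x = 0})"

text \<open>The greatest such subspace exists, so the definition is not vacuous.\<close>

lemma AB_invariant_sum:
  fixes A :: "real^'n^'n" and B :: "real^'m^'n"
  assumes V: "AB_invariant A B V" and W: "AB_invariant A B W"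
  shows "AB_invariant A B {v + w |v w. v \<in> V \<and> w \<in> W}" (is "AB_invariant A B ?S")
proof -
  obtain F where sV: "subspace V" and F: "(*v) (A + B ** F) ` V \<subseteq> V"
    using V unfolding AB_invariant_def by blast
  obtain G where sW: "subspace W" and G: "(*v) (A + B ** G) ` W \<subseteq> W"
    using W unfolding AB_invariant_def by blast
  have sS: "subspace ?S" using subspace_sums[OF sV sW] .
  have "\<exists>p. A *v b + B *v p \<in> ?S" if "b \<in> ?S" for b
  proof -
    obtain v w where vw: "v \<in> V" "w \<in> W" "b = v + w" using \<open>b \<in> ?S\<close> by blast
    have "A *v b + B *v (F *v v + G *v w) = (A + B ** F) *v v + (A + B ** G) *v w"
      by (simp add: vw matrix_vector_mult_add_rdistrib matrix_vector_mul_assoc algebra_simps)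
    moreover have "(A + B ** F) *v v \<in> V" "(A + B ** G) *v w \<in> W" using F G vw by auto
    ultimately show ?thesis by (intro exI[of _ "F *v v + G *v w"]) auto
  qed
  note ex = this
  define p where "p b = (SOME q. A *v b + B *v q \<in> ?S)" for b
  have p: "A *v b + B *v p b \<in> ?S" if "b \<in> ?S" for b
    unfolding p_def by (rule someI_ex) (rule ex[OF that])
  obtain D where D: "D \<subseteq> ?S" "independent D" "?S \<subseteq> span D"
    using maximal_independent_subset by blast
  obtain g where g: "linear g" "\<forall>x\<in>D. g x = p x"
    using linear_independent_extend[OF D(2)] by blast
  have "(A + B ** matrix g) *v x \<in> ?S" if "x \<in> D" for x
  proof -
    have "x \<in> ?S" using D(1) that by blast
    moreover have "matrix g *v x = p x" using g that by (simp add: matrix_works)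
    ultimately show ?thesis using p[of x]
      by (simp only: matrix_vector_mult_add_rdistrib matrix_vector_mul_assoc [symmetric])
  qed
  then have "span D \<subseteq> (*v) (A + B ** matrix g) -` ?S"
    by (intro span_minimal linear_subspace_vimage sS matrix_vector_mul_linear) blast
  then have "(*v) (A + B ** matrix g) ` ?S \<subseteq> ?S" using D(3) by blast
  with sS show ?thesis unfolding AB_invariant_def by (intro conjI exI)
qed

lemma max_AB_invariant_in_ker_greatest:
  fixes A :: "real^'n^'n" and B :: "real^'m^'n" and C :: "real^'n^'l"
  defines "S \<equiv> max_AB_invariant_in_ker A B C"
  shows "AB_invariant A B S \<and> S \<subseteq> {x. C *v x = 0}"
    and "\<And>V. AB_invariant A B V \<Longrightarrow> V \<subseteq> {x. C *v x = 0} \<Longrightarrow> V \<subseteq> S"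
proof -
  define P where "P = (\<lambda>V. AB_invariant A B V \<and> V \<subseteq> {x. C *v x = 0})"
  have "P {0}" by (simp add: P_def AB_invariant_def)
  moreover have "\<forall>V. P V \<longrightarrow> dim V < Suc CARD('n)"
    by (simp add: less_Suc_eq_le dim_subset_UNIV_cart[where 'n = 'n])
  ultimately have "\<exists>V. P V \<and> (\<forall>W. P W \<longrightarrow> dim W \<le> dim V)"
    by (rule ex_has_greatest_nat)
  then obtain V where V: "P V" and max: "\<And>W. P W \<Longrightarrow> dim W \<le> dim V" by blast
  have le: "W \<le> V" if W: "P W" for W
  proof -
    let ?S = "{v + w |v w. v \<in> V \<and> w \<in> W}"
    have "?S \<subseteq> {x. C *v x = 0}"
      using V W unfolding P_def by (auto simp: matrix_vector_right_distrib subset_iff)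
    moreover have "AB_invariant A B ?S" using V W by (intro AB_invariant_sum) (simp_all add: P_def)
    ultimately have "P ?S" by (simp only: P_def)
    have z: "0 \<in> V" "0 \<in> W" using V W unfolding P_def AB_invariant_def by (auto simp: subspace_0)
    have "V \<subseteq> ?S"
    proof
      fix v assume "v \<in> V"
      with z have "v = v + 0 \<and> v \<in> V \<and> 0 \<in> W" by simp
      then show "v \<in> ?S" by blast
    qed
    have "W \<subseteq> ?S"
    proof
      fix w assume "w \<in> W"
      with z have "w = 0 + w \<and> 0 \<in> V \<and> w \<in> W" by simp
      then show "w \<in> ?S" by blast
    qed
    moreover have "subspace V" "subspace ?S"
      using V \<open>P ?S\<close> by (simp_all only: P_def AB_invariant_def)
    then have "V = ?S" using \<open>V \<subseteq> ?S\<close> max[OF \<open>P ?S\<close>] by (rule subspace_dim_equal)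
    ultimately show ?thesis by simp
  qed
  have "S = V" unfolding S_def max_AB_invariant_in_ker_def
    using Greatest_equality[of P V, OF V le] by (simp only: P_def)
  then show "AB_invariant A B S \<and> S \<subseteq> {x. C *v x = 0}"
    "\<And>V. AB_invariant A B V \<Longrightarrow> V \<subseteq> {x. C *v x = 0} \<Longrightarrow> V \<subseteq> S"
    using V le unfolding P_def by auto
qed

text \<open>The (complex) eigenvalues of the restriction of a real matrix \<open>M\<close> to an invariant real
  subspace \<open>S\<close>: an eigenvector lies in the complexification of \<open>S\<close>, which consists of the complex
  vectors whose real and imaginary parts both belong to \<open>S\<close>.\<close>

definition restriction_eigenvalue :: "real^'n^'n \<Rightarrow> (real^'n) set \<Rightarrow> complex \<Rightarrow> bool" where
  "restriction_eigenvalue M S \<mu> \<longleftrightarrow>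
     (\<exists>z :: complex^'n. z \<noteq> 0 \<and> (\<chi> i. Re (z $ i)) \<in> S \<and> (\<chi> i. Im (z $ i)) \<in> S \<and>
        map_matrix complex_of_real M *v z = \<mu> *s z)"

text \<open>For a left-invertible system the eigenvalues do not depend on the choice of \<open>F\<close>.\<close>

definition transmission_zeros ::
    "real^'n^'n \<Rightarrow> real^'m^'n \<Rightarrow> real^'n^'l \<Rightarrow> complex set" where
  "transmission_zeros A B C =
     (let S = max_AB_invariant_in_ker A B C in
       {\<mu>. \<exists>F :: real^'n^'m. (*v) (A + B ** F) ` S \<subseteq> S \<and> restriction_eigenvalue (A + B ** F) S \<mu>})"


section \<open>Comparison functions\<close>

text \<open>Functions on \<open>[0, \<infinity>)\<close> are represented by functions on \<^typ>\<open>real\<close> that are only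
  constrained on \<open>{0..}\<close>. Nonnegativity of their values there follows from \<open>\<alpha> 0 = 0\<close> and
  monotonicity.\<close>

definition class_K :: "(real \<Rightarrow> real) \<Rightarrow> bool" where
  "class_K \<alpha> \<longleftrightarrow> continuous_on {0..} \<alpha> \<and> strict_mono_on {0..} \<alpha> \<and> \<alpha> 0 = 0"

definition class_K_inf :: "(real \<Rightarrow> real) \<Rightarrow> bool" where
  "class_K_inf \<alpha> \<longleftrightarrow> class_K \<alpha> \<and> \<not> bounded (\<alpha> ` {0..})"

text \<open>Monotonicity in \<open>t\<close> cannot be strict, since \<open>\<beta> 0 t = 0\<close> for all \<open>t \<ge> 0\<close>.\<close>

definition class_KL :: "(real \<Rightarrow> real \<Rightarrow> real) \<Rightarrow> bool" where
  "class_KL \<beta> \<longleftrightarrow>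
     (\<forall>t\<ge>0. class_K (\<lambda>s. \<beta> s t)) \<and>
     (\<forall>s\<ge>0. antimono_on {0..} (\<beta> s) \<and> (\<beta> s \<longlongrightarrow> 0) at_top)"


section \<open>Signals on the half-line\<close>

text \<open>Signals live on \<open>[0, \<infinity>)\<close>; derivatives are taken within \<open>{0..}\<close>, hence are one-sided at \<open>0\<close>.\<close>

definition nth_deriv :: "nat \<Rightarrow> (real \<Rightarrow> 'a::real_normed_vector) \<Rightarrow> real \<Rightarrow> 'a" where
  "nth_deriv k z = ((\<lambda>w t. vector_derivative w (at t within {0..})) ^^ k) z"

definition cont_differentiable :: "nat \<Rightarrow> (real \<Rightarrow> 'a::real_normed_vector) \<Rightarrow> bool" where
  "cont_differentiable k z \<longleftrightarrow>
     (\<forall>j<k. \<forall>t\<ge>0. nth_deriv j z differentiable (at t within {0..})) \<and>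
     continuous_on {0..} (nth_deriv k z)"

text \<open>The Euclidean norm of \<open>\<^bold>y\<^sup>N(t)\<close>, the vector with entries \<open>y\<^sub>i\<^sup>(\<^sup>k\<^sup>)(t)\<close> indexed by the pairs
  \<open>(i, k)\<close> with \<open>i\<close> in the index type \<open>'l\<close> and \<open>k \<le> N\<close>.\<close>

definition jet_norm :: "nat \<Rightarrow> (real \<Rightarrow> real^'l) \<Rightarrow> real \<Rightarrow> real" where
  "jet_norm N y t = L2_set (\<lambda>(i, k). nth_deriv k (\<lambda>s. y s $ i) t) (UNIV \<times> {..N})"

text \<open>The essential supremum over \<open>[a, b]\<close> of a nonnegative function \<open>g\<close> (the pointwise norm of a
  signal). The interval \<open>[a, a]\<close> is a null set, on which the essential supremum carries no
  information; there we use the value \<open>g a\<close>, which for continuous \<open>g\<close> is the limit as \<open>b\<close> decreases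
  to \<open>a\<close>.\<close>

definition ess_sup_on :: "real \<Rightarrow> real \<Rightarrow> (real \<Rightarrow> real) \<Rightarrow> real" where
  "ess_sup_on a b g =
     (if a < b then real_of_ereal (esssup (lebesgue_on {a..b}) (\<lambda>s. ereal (g s))) else g a)"


section \<open>Output-input stability\<close>

definition solves ::
    "real^'n^'n \<Rightarrow> real^'m^'n \<Rightarrow> (real \<Rightarrow> real^'m) \<Rightarrow> (real \<Rightarrow> real^'n) \<Rightarrow> bool" where
  "solves A B u x \<longleftrightarrow>
     (\<forall>t\<ge>0. (x has_vector_derivative (A *v x t + B *v u t)) (at t within {0..}))"

text \<open>Solutions of a linear system with continuous input are defined on all of \<open>[0, \<infinity>)\<close> and are
  determined by \<open>x 0\<close> and \<open>u\<close>, so quantifying over \<open>u\<close> and \<open>x\<close> amounts to quantifying over inputs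
  and initial states. The norm on pairs is the Euclidean norm of the stacked vector.\<close>

definition output_input_stable ::
    "real^'n^'n \<Rightarrow> real^'m^'n \<Rightarrow> real^'n^'l \<Rightarrow> bool" where
  "output_input_stable A B C \<longleftrightarrow>
     (\<exists>N \<beta> \<gamma>. N \<ge> 1 \<and> class_KL \<beta> \<and> class_K_inf \<gamma> \<and>
        (\<forall>u x. cont_differentiable (N - 1) u \<and> solves A B u x \<longrightarrow>
           (\<forall>t\<ge>0. norm (u t, x t)
              \<le> \<beta> (norm (x 0)) t + \<gamma> (ess_sup_on 0 t (jet_norm N (\<lambda>s. C *v x s))))))"

end

theory Submission
  imports
    Defs
    "HOL-Computational_Algebra.Fundamental_Theorem_Algebra"
begin

text \<open>If \<open>\<mu>\<close> is a transmission zero, an eigenvector of \<open>A + BF\<close> in the largest output-nulling subspace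
  \<open>S\<close> gives a trajectory \<open>e\<^sup>\<mu>\<^sup>t z\<close> with zero output, so stability forces \<open>Re \<mu> < 0\<close>.

  Conversely, the subspaces \<open>W\<^sub>k\<close> of states from which the output can be annihilated to order \<open>k\<close>
  decrease, and once they stabilise they are contained in \<open>S\<close>. Hence the state modulo \<open>S\<close> is bounded
  by finitely many output derivatives. Left-invertibility says that \<open>B v \<in> S\<close> only for \<open>v = 0\<close>, so
  \<open>u - F x\<close> is bounded in the same way. The projection of \<open>x\<close> to \<open>S\<close> then solves a linear equation
  with a stable matrix and a forcing term that is bounded by the output derivatives.\<close>

section \<open>Linear maps\<close>

text \<open>All estimates are linear, and so are the comparison functions that come out of them. In
  finite dimension an inclusion of kernels is a norm inequality, which turns each statement
  "vanishing outputs force the state into a subspace" into a bound. The jet has one order more than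
  the index at which the subspaces \<open>W\<^sub>k\<close> stabilise, because the input is
  recovered from the state together with its derivative. No basis of \<open>S\<close> is chosen.
  With a projection \<open>P\<close> onto \<open>S\<close> and \<open>M = A + BF\<close>, the
  restriction of \<open>M\<close> to \<open>S\<close> is extended to
  \<open>G = PMP - (1 - P)\<close> on the whole space; this adds at most the eigenvalue -1, so the
  hypothesis on the zeros says that \<open>G\<close> is Hurwitz. Decay for \<open>G\<close> is
  obtained without a matrix exponential or a normal form: an annihilating product of factors
  \<open>G - \<mu>\<close>, with eigenvalues \<open>\<mu>\<close> only, reduces the equation to
  successive equations z' = \<mu> z + forcing. Each of them gives up part of the decay rate, which
  absorbs the polynomial factors that multiple eigenvalues would produce. Zeros are collected over
  all feedbacks preserving \<open>S\<close>: necessity treats an arbitrary such \<open>F\<close>,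
  sufficiency fixes one.\<close>

lemma linear_bound_of_kernel_subset:
  fixes f :: "'a::euclidean_space \<Rightarrow> 'b::euclidean_space"
    and g :: "'a \<Rightarrow> 'c::real_normed_vector"
  assumes f: "linear f" and g: "linear g" and ker: "\<And>x. f x = 0 \<Longrightarrow> g x = 0"
  obtains K where "K > 0" "\<And>x. norm (g x) \<le> K * norm (f x)"
proof -
  define T where "T = {x. f x = 0}"
  \<comment> \<open>The orthogonal complement of the kernel of \<open>f\<close>. There
    \<open>f\<close> is injective, hence bounded below by some \<open>e\<close>; the kernel
    component of a vector contributes neither to \<open>f\<close> nor to \<open>g\<close>.\<close>
  define S where "S = {y. \<forall>x\<in>T. orthogonal x y}"
  have sT: "subspace T" unfolding T_def by (rule linear_subspace_kernel[OF f])
  have sS: "subspace S" unfolding S_def by (simp add: subspace_orthogonal_to_vectors)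
  have inj: "\<forall>x\<in>S. f x = 0 \<longrightarrow> x = 0"
    unfolding S_def T_def orthogonal_def by auto
  obtain e where e: "e > 0" "\<forall>x\<in>S. norm (f x) \<ge> e * norm x"
    using injective_imp_isometric[OF closed_subspace[OF sS] sS linear_conv_bounded_linear[THEN iffD1, OF f] inj]
    by blast
  have "bounded_linear g" using g linear_conv_bounded_linear by blast
  then obtain M where M: "M > 0" "\<And>x. norm (g x) \<le> norm x * M"
    using bounded_linear.pos_bounded by blast
  have bound: "norm (g x) \<le> (M / e) * norm (f x)" for x
  proof -
    obtain y z where yz: "y \<in> span T" "\<And>w. w \<in> span T \<Longrightarrow> orthogonal z w" "x = y + z"
      using orthogonal_subspace_decomp_exists[of T x] by blast
    have y: "f y = 0" using yz(1) sT by (simp add: T_def span_eq_iff[THEN iffD2])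
    have z: "z \<in> S" unfolding S_def using yz(2) by (auto simp: span_base orthogonal_commute)
    have "norm (g x) = norm (g z)" using yz(3) ker[OF y] linear_add[OF g] by simp
    also have "\<dots> \<le> norm z * M" by (rule M)
    also have "\<dots> \<le> (norm (f z) / e) * M"
      using e z M(1) by (intro mult_right_mono) (auto simp: field_simps)
    also have "f z = f x" using yz(3) y linear_add[OF f] by simp
    finally show ?thesis by (simp add: mult.commute)
  qed
  show ?thesis by (rule that[of "M / e", OF _ bound]) (use M e in auto)
qed

text \<open>The projection is delivered as a matrix so that it can be multiplied with the system
  matrices and transported entrywise to rational functions or complex numbers.\<close>

lemma subspace_projection:
  fixes S :: "(real^'n) set"
  assumes "subspace S"
  obtains P :: "real^'n^'n" where "\<And>x. P *v x \<in> S" "\<And>x. x \<in> S \<Longrightarrow> P *v x = x"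
proof -
  obtain g where g: "range g \<subseteq> S" "linear g" "\<forall>v\<in>S. g v = v"
    using linear_exists_left_inverse_on[of id S] assms linear_id by auto
  show ?thesis
    by (rule that[of "matrix g"]) (use g in \<open>auto simp: matrix_works\<close>)
qed

section \<open>Consequences of left-invertibility\<close>

lemma ratfun_const_simps [simp]:
  "ratfun_const 0 = 0" "ratfun_const 1 = 1"
  "ratfun_const (a + b) = ratfun_const a + ratfun_const b"
  "ratfun_const (a - b) = ratfun_const a - ratfun_const b"
  "ratfun_const (a * b) = ratfun_const a * ratfun_const b"
  by (simp_all add: ratfun_const_def Zero_fract_def mult.commute One_fract_def one_pCons
      del: One_fract_def[symmetric])

lemma ratfun_const_sum: "ratfun_const (sum f I) = (\<Sum>i\<in>I. ratfun_const (f i))"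
  by (induction I rule: infinite_finite_induct) auto

lemma ratfun_const_eq_0_iff [simp]: "ratfun_const a = 0 \<longleftrightarrow> a = 0"
  by (simp add: ratfun_const_def eq_fract Zero_fract_def)

lemma ratfun_s_nonzero [simp]: "ratfun_s \<noteq> 0"
  by (simp add: ratfun_s_def eq_fract Zero_fract_def)

abbreviation ratfun_mat :: "real^'a^'b \<Rightarrow> (real poly fract)^'a^'b" where
  "ratfun_mat \<equiv> map_matrix ratfun_const"

abbreviation ratfun_vec :: "real^'a \<Rightarrow> (real poly fract)^'a" where
  "ratfun_vec v \<equiv> (\<chi> i. ratfun_const (v $ i))"

lemma ratfun_mat_mult: "ratfun_mat (A ** B) = ratfun_mat A ** ratfun_mat B"
  by (simp add: vec_eq_iff matrix_matrix_mult_def ratfun_const_sum)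

lemma ratfun_mat_add: "ratfun_mat (A + B) = ratfun_mat A + ratfun_mat B"
  by (simp add: vec_eq_iff)

lemma ratfun_mat_mult_vec: "ratfun_mat A *v ratfun_vec v = ratfun_vec (A *v v)"
  by (simp add: vec_eq_iff matrix_vector_mult_def ratfun_const_sum)

lemma fract_vec_common_denominator:
  fixes x :: "'a::idom fract^'n"
  obtains d p where "d \<noteq> 0" "\<And>i. x $ i = Fraction_Field.Fract (p i) d"
proof -
  have "\<exists>a b. b \<noteq> 0 \<and> x $ i = Fraction_Field.Fract a b" for i
    by (cases "x $ i") auto
  then obtain a b where ab: "\<And>i. b i \<noteq> 0" "\<And>i. x $ i = Fraction_Field.Fract (a i) (b i)"
    by metis
  define d where "d = (\<Prod>i\<in>UNIV. b i)"
  have d: "d \<noteq> 0" using ab(1) by (simp add: d_def)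
  have x: "x $ i = Fraction_Field.Fract (a i * (\<Prod>j\<in>UNIV-{i}. b j)) d" for i
  proof -
    have "d = b i * (\<Prod>j\<in>UNIV-{i}. b j)" unfolding d_def by (rule prod.remove) auto
    then have "a i * d = a i * (\<Prod>j\<in>UNIV-{i}. b j) * b i" by (simp only: mult_ac)
    then show ?thesis using ab d by (simp only: eq_fract not_False_eq_True)
  qed
  show ?thesis by (rule that[OF d x])
qed

lemma fract_add_same_denominator:
  "d \<noteq> 0 \<Longrightarrow> Fraction_Field.Fract a d + Fraction_Field.Fract b d = Fraction_Field.Fract (a + b) (d::'a::idom)"
  by (simp add: eq_fract algebra_simps)

lemma fract_sum_same_denominator:
  assumes "d \<noteq> (0::'a::idom)"
  shows "(\<Sum>i\<in>I. Fraction_Field.Fract (f i) d) = Fraction_Field.Fract (sum f I) d"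
proof (induction I rule: infinite_finite_induct)
  case (insert x F)
  then show ?case using assms by (simp add: fract_add_same_denominator del: add_fract)
qed (use assms in \<open>simp_all add: Zero_fract_def eq_fract\<close>)

text \<open>After clearing denominators, compare degrees in \<open>s p = M p\<close>.\<close>

lemma resolvent_ker:
  fixes M :: "real^'n^'n"
  assumes eq: "(mat ratfun_s - ratfun_mat M) *v x = 0"
  shows "x = 0"
proof (rule ccontr)
  assume "x \<noteq> 0"
  obtain d p where d: "d \<noteq> 0" and p: "\<And>i. x $ i = Fraction_Field.Fract (p i) d"
    using fract_vec_common_denominator by blast
  have poly_eq: "pCons 0 (p i) = (\<Sum>j\<in>UNIV. smult (M $ i $ j) (p j))" for i
  proof -
    have "ratfun_s * x $ i = (\<Sum>j\<in>UNIV. ratfun_const (M $ i $ j) * x $ j)"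
    proof -
      have "(mat ratfun_s *v x) $ i = (ratfun_mat M *v x) $ i"
        using eq by (simp add: matrix_vector_mult_diff_rdistrib)
      then show ?thesis
        by (simp add: matrix_vector_mult_def mat_def if_distrib if_distribR cong: if_cong)
    qed
    also have "\<dots> = (\<Sum>j\<in>UNIV. Fraction_Field.Fract (smult (M $ i $ j) (p j)) d)"
      by (simp add: p ratfun_const_def)
    also have "\<dots> = Fraction_Field.Fract (\<Sum>j\<in>UNIV. smult (M $ i $ j) (p j)) d"
      by (rule fract_sum_same_denominator[OF d])
    finally have "pCons 0 (p i) * d = (\<Sum>j\<in>UNIV. smult (M $ i $ j) (p j)) * d"
      using d by (simp add: p ratfun_s_def eq_fract)
    then show ?thesis using d by (metis mult_right_cancel)
  qed
  obtain i0 where "x $ i0 \<noteq> 0" using \<open>x \<noteq> 0\<close> by (auto simp: vec_eq_iff)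
  then have i0: "p i0 \<noteq> 0" using d by (auto simp: p Zero_fract_def eq_fract)
  \<comment> \<open>A component of maximal degree gives the contradiction: multiplication by
    \<open>s\<close> raises its degree by one, while a combination of components with constant
    coefficients stays below the maximum.\<close>
  have "\<exists>i. p i \<noteq> 0 \<and> (\<forall>j. p j \<noteq> 0 \<longrightarrow> degree (p j) \<le> degree (p i))"
  proof -
    have "finite {i. p i \<noteq> 0}" "{i. p i \<noteq> 0} \<noteq> {}" using i0 by auto
    then have "Max ((\<lambda>i. degree (p i)) ` {i. p i \<noteq> 0}) \<in> (\<lambda>i. degree (p i)) ` {i. p i \<noteq> 0}"
      by (intro Max_in) auto
    then obtain i where "p i \<noteq> 0" "degree (p i) = Max ((\<lambda>i. degree (p i)) ` {i. p i \<noteq> 0})"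
      by auto
    then show ?thesis by (intro exI[of _ i]) auto
  qed
  then obtain i where i: "p i \<noteq> 0" and max: "\<And>j. p j \<noteq> 0 \<Longrightarrow> degree (p j) \<le> degree (p i)" by blast
  have "degree (\<Sum>j\<in>UNIV. smult (M $ i $ j) (p j)) \<le> degree (p i)"
  proof (rule degree_sum_le)
    fix j show "degree (smult (M $ i $ j) (p j)) \<le> degree (p i)"
      using max[of j] by (cases "p j = 0") (auto intro: order_trans[OF degree_smult_le])
  qed simp
  then show False using i poly_eq[of i, symmetric] by simp
qed

text \<open>A square matrix over a field with trivial kernel is invertible. Both identities are
  extracted from the choice operator that defines \<open>matrix_inv\<close>.\<close>

lemma resolvent_inverse:
  fixes M :: "real^'n^'n"
  shows "matrix_inv (mat ratfun_s - ratfun_mat M) ** (mat ratfun_s - ratfun_mat M) = mat 1"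
    and "(mat ratfun_s - ratfun_mat M) ** matrix_inv (mat ratfun_s - ratfun_mat M) = mat 1"
proof -
  have "invertible (mat ratfun_s - ratfun_mat M)"
    using resolvent_ker unfolding invertible_left_inverse matrix_left_invertible_ker by blast
  then have "\<exists>R. (mat ratfun_s - ratfun_mat M) ** R = mat 1 \<and> R ** (mat ratfun_s - ratfun_mat M) = mat 1"
    by (simp add: invertible_def)
  from someI_ex[OF this]
  show "matrix_inv (mat ratfun_s - ratfun_mat M) ** (mat ratfun_s - ratfun_mat M) = mat 1"
    "(mat ratfun_s - ratfun_mat M) ** matrix_inv (mat ratfun_s - ratfun_mat M) = mat 1"
    unfolding matrix_inv_def by simp_all
qed

text \<open>Rank \<open>CARD('m)\<close> makes the rows span the whole space, which yields a left
  inverse.\<close>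

lemma left_invertible_ker:
  assumes "left_invertible A B C" "transfer_matrix A B C *v u = 0"
  shows "u = 0"
proof -
  have "vec.span (rows (transfer_matrix A B C)) = UNIV"
    using assms(1) unfolding left_invertible_def row_rank_def_gen
    by (metis vec.dim_eq_full vec.dimension_def card_cart_basis)
  then show ?thesis
    using assms(2) matrix_left_invertible_span_rows_gen matrix_left_invertible_ker by metis
qed

text \<open>The rational vector \<open>x = (s - PM)\<^sup>-\<^sup>1 B v\<close>, with \<open>P\<close> a projection onto \<open>S\<close>, lies in the
  extension of \<open>S\<close> to the field of rational functions. It is a state trajectory with zero output
  driven by the input \<open>v + F x\<close>.\<close>

lemma left_invertible_range_Int:
  fixes A :: "real^'n^'n" and B :: "real^'m^'n" and C :: "real^'n^'l" and F :: "real^'n^'m"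
  assumes li: "left_invertible A B C" and sS: "subspace S"
    and inv: "(*v) (A + B ** F) ` S \<subseteq> S" and ker: "S \<subseteq> {x. C *v x = 0}"
    and Bv: "B *v v \<in> S"
  shows "v = 0"
proof -
  obtain P :: "real^'n^'n" where P: "\<And>x. P *v x \<in> S" "\<And>x. x \<in> S \<Longrightarrow> P *v x = x"
    using subspace_projection[OF sS] by blast
  define M where "M = A + B ** F"
  have PP: "P ** P = P" and PMP: "P ** (M ** P) = M ** P" and CP: "C ** P = 0"
    using P inv ker unfolding matrix_eq M_def
    by (auto simp: matrix_vector_mul_assoc[symmetric])
  define b where "b = ratfun_mat B *v ratfun_vec v"
  have Pb: "ratfun_mat P *v b = b"
    using P(2)[OF Bv] by (simp add: b_def ratfun_mat_mult_vec)
  define x where "x = matrix_inv (mat ratfun_s - ratfun_mat (P ** M)) *v b"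
  have mats: "mat c *v y = c *s y" for c :: "real poly fract" and y :: "(real poly fract)^'n"
    by (simp add: vec_eq_iff matrix_vector_mult_def mat_def if_distrib if_distribR cong: if_cong)
  have "(mat ratfun_s - ratfun_mat (P ** M)) *v x = b"
    by (simp add: x_def matrix_vector_mul_assoc resolvent_inverse)
  then have sx: "ratfun_s *s x = ratfun_mat (P ** M) *v x + b"
    by (simp add: matrix_vector_mult_diff_rdistrib mats algebra_simps)
  \<comment> \<open>Apply \<open>P\<close> to s x = PM x + b. Since \<open>P\<close> is idempotent
    and fixes \<open>b\<close>, the right-hand side does not change, so s (P x) = s x, and
    \<open>s\<close> cancels.\<close>
  have Px: "ratfun_mat P *v x = x"
  proof -
    have "ratfun_s *s (ratfun_mat P *v x) = ratfun_mat P *v (ratfun_s *s x)"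
      by (simp add: vector_scalar_commute)
    also have "\<dots> = ratfun_mat (P ** P ** M) *v x + b"
      by (simp add: sx matrix_vector_right_distrib Pb matrix_vector_mul_assoc
          flip: ratfun_mat_mult matrix_mul_assoc)
    also have "\<dots> = ratfun_s *s x" by (simp add: PP sx)
    finally show ?thesis by (simp add: vec_eq_iff)
  qed
  have "ratfun_mat (P ** M) *v x = ratfun_mat (P ** M) *v (ratfun_mat P *v x)"
    by (simp only: Px)
  also have "\<dots> = ratfun_mat M *v (ratfun_mat P *v x)"
    by (simp add: matrix_vector_mul_assoc PMP flip: ratfun_mat_mult matrix_mul_assoc)
  finally have PMx: "ratfun_mat (P ** M) *v x = ratfun_mat M *v x" by (simp only: Px)
  define u where "u = ratfun_vec v + ratfun_mat F *v x"
  have "(mat ratfun_s - ratfun_mat A) *v x = ratfun_mat B *v u"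
  proof -
    have "ratfun_s *s x = ratfun_mat A *v x + ratfun_mat B *v (ratfun_mat F *v x) + b"
      using sx unfolding PMx
      by (simp add: M_def ratfun_mat_add ratfun_mat_mult matrix_vector_mult_add_rdistrib
          matrix_vector_mul_assoc)
    then show ?thesis
      by (simp add: matrix_vector_mult_diff_rdistrib mats u_def matrix_vector_right_distrib b_def)
  qed
  then have x: "matrix_inv (mat ratfun_s - ratfun_mat A) *v (ratfun_mat B *v u) = x"
    by (metis matrix_vector_mul_assoc matrix_vector_mul_lid resolvent_inverse(1))
  have "ratfun_mat C *v x = ratfun_mat C *v (ratfun_mat P *v x)" by (simp only: Px)
  also have "\<dots> = 0"
    by (simp add: matrix_vector_mul_assoc CP flip: ratfun_mat_mult)
       (simp add: vec_eq_iff matrix_vector_mult_def)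
  finally have "transfer_matrix A B C *v u = 0"
    unfolding transfer_matrix_def by (simp add: x flip: matrix_vector_mul_assoc)
  \<comment> \<open>Now x = (s - A)^-1 B u vanishes together with \<open>u\<close>, and v = u - F x
    = 0 follows.\<close>
  then have u: "u = 0" by (rule left_invertible_ker[OF li])
  then have "x = 0" using x by simp
  with u show ?thesis by (simp add: u_def vec_eq_iff)
qed

section \<open>Recovering the state from the output\<close>

text \<open>The subspaces \<open>W\<^sub>k\<close> of the invariant subspace algorithm of geometric
  control. Index \<open>k\<close> corresponds to the vanishing of the \<open>k + 1\<close> values y,
  y', ..., y^(k), so index 0 is already the kernel of \<open>C\<close>.\<close>

primrec output_nulling ::
    "real^'n^'n \<Rightarrow> real^'m^'n \<Rightarrow> real^'n^'l \<Rightarrow> nat \<Rightarrow> (real^'n) set" where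
  "output_nulling A B C 0 = {x. C *v x = 0}"
| "output_nulling A B C (Suc k) = {x. C *v x = 0 \<and> (\<exists>u. A *v x + B *v u \<in> output_nulling A B C k)}"

lemma subspace_output_nulling: "subspace (output_nulling A B C k)"
proof (induction k)
  case (Suc k)
  have "\<exists>u. A *v (x + y) + B *v u \<in> output_nulling A B C k"
    if "A *v x + B *v u \<in> output_nulling A B C k" "A *v y + B *v v \<in> output_nulling A B C k"
    for x y u v
    using subspace_add[OF Suc that]
    by (intro exI[of _ "u + v"]) (simp add: matrix_vector_right_distrib algebra_simps)
  moreover have "\<exists>u. A *v (c *\<^sub>R x) + B *v u \<in> output_nulling A B C k"
    if "A *v x + B *v u \<in> output_nulling A B C k" for x u c
    using subspace_scale[OF Suc that, of c]
    by (intro exI[of _ "c *\<^sub>R u"]) (simp add: matrix_vector_mult_scaleR scaleR_right_distrib)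
  moreover have "\<exists>u. A *v 0 + B *v u \<in> output_nulling A B C k"
    by (intro exI[of _ 0]) (simp add: subspace_0[OF Suc])
  ultimately show ?case
    by (auto simp: subspace_def matrix_vector_right_distrib matrix_vector_mult_scaleR)
qed (simp add: subspace_def matrix_vector_right_distrib matrix_vector_mult_scaleR)

lemma output_nulling_Suc_subset: "output_nulling A B C (Suc k) \<subseteq> output_nulling A B C k"
  by (induction k) auto

text \<open>Every strict inclusion lowers the dimension by at least one, so there are at most
  \<open>dim (?W 0)\<close> of them.\<close>

lemma output_nulling_stabilises:
  obtains k where "output_nulling A B C (Suc k) = output_nulling A B C k"
proof -
  let ?W = "output_nulling A B C"
  have False if ne: "\<And>k. ?W (Suc k) \<noteq> ?W k"
  proof -
    have less: "dim (?W (Suc k)) < dim (?W k)" for k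
      using subspace_dim_equal[OF subspace_output_nulling subspace_output_nulling
          output_nulling_Suc_subset] ne not_le by metis
    have "dim (?W k) + k \<le> dim (?W 0)" for k
    proof (induction k)
      case (Suc k)
      then show ?case using less[of k] by linarith
    qed simp
    from this[of "Suc (dim (?W 0))"] show False by simp
  qed
  then show ?thesis using that by blast
qed

text \<open>Inputs chosen point by point need not depend linearly on the state. Keeping them on a
  basis of \<open>W\<close> only and extending linearly produces the feedback.\<close>

lemma AB_invariantI:
  fixes A :: "real^'n^'n" and B :: "real^'m^'n"
  assumes "subspace W" "\<And>x. x \<in> W \<Longrightarrow> \<exists>u. A *v x + B *v u \<in> W"
  shows "AB_invariant A B W"
proof -
  obtain p where p: "\<And>x. x \<in> W \<Longrightarrow> A *v x + B *v p x \<in> W" using assms(2) by metis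
  obtain D where D: "D \<subseteq> W" "independent D" "W \<subseteq> span D"
    using maximal_independent_subset by blast
  obtain g where g: "linear g" "\<forall>x\<in>D. g x = p x"
    using linear_independent_extend[OF D(2)] by blast
  have "(A + B ** matrix g) *v x \<in> W" if "x \<in> D" for x
    using p[of x] g D(1) that
    by (auto simp: matrix_vector_mult_add_rdistrib matrix_works simp flip: matrix_vector_mul_assoc)
  then have "span D \<subseteq> (*v) (A + B ** matrix g) -` W"
    by (intro span_minimal linear_subspace_vimage assms(1) matrix_vector_mul_linear) blast
  then have "(*v) (A + B ** matrix g) ` W \<subseteq> W" using D(3) by blast
  then show ?thesis unfolding AB_invariant_def using assms(1) by blast
qed

text \<open>At a fixpoint each state of \<open>W\<^sub>k\<close> has an input steering it back into
  \<open>W\<^sub>k\<close>, which is the pointwise form of (A,B)-invariance.\<close>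

lemma output_nulling_fixpoint_subset:
  assumes "output_nulling A B C (Suc k) = output_nulling A B C k"
  shows "output_nulling A B C k \<subseteq> max_AB_invariant_in_ker A B C"
proof (rule max_AB_invariant_in_ker_greatest(2))
  show "AB_invariant A B (output_nulling A B C k)"
    by (rule AB_invariantI[OF subspace_output_nulling]) (use assms in auto)
  show "output_nulling A B C k \<subseteq> {x. C *v x = 0}" by (cases k) auto
qed

text \<open>Here \<open>X j\<close> and \<open>U j\<close> stand for the \<open>j\<close>-th derivatives of state and input at one time.\<close>

lemma output_jet_bound:
  fixes A :: "real^'n^'n" and B :: "real^'m^'n" and C :: "real^'n^'l" and g :: "real^'n \<Rightarrow> real^'n"
  assumes "linear g" "\<And>x. x \<in> output_nulling A B C k \<Longrightarrow> g x = 0"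
  shows "\<exists>K\<ge>0. \<forall>X U. (\<forall>j<k. X (Suc j) = A *v X j + B *v U j) \<longrightarrow>
           norm (g (X 0)) \<le> K * (\<Sum>j\<le>k. norm (C *v X j))"
  using assms
\<comment> \<open>\<open>g\<close> is generalised because the induction hypothesis is applied to the
  map \<open>Q\<close> that measures the distance to \<open>W\<^sub>k\<close>, not to
  \<open>g\<close> itself.\<close>
proof (induction k arbitrary: g)
  case 0
  obtain K where K: "K > 0" "\<And>x. norm (g x) \<le> K * norm (C *v x)"
    by (rule linear_bound_of_kernel_subset[of "(*v) C" g]) (use 0 in auto)
  show ?case by (rule exI[of _ K]) (use K in auto)
next
  case (Suc k)
  obtain P where P: "\<And>x. P *v x \<in> output_nulling A B C k"
      "\<And>x. x \<in> output_nulling A B C k \<Longrightarrow> P *v x = x"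
    using subspace_projection[OF subspace_output_nulling] by blast
  define Q where "Q x = x - P *v x" for x
  have Q: "linear Q" unfolding Q_def
    by (intro linear_compose_sub linear_ident matrix_vector_mul_linear)
  have Q0: "Q x = 0 \<longleftrightarrow> x \<in> output_nulling A B C k" for x
    using P[of x] by (auto simp: Q_def)
  obtain K' where K': "K' \<ge> 0" and IH: "\<And>X U. \<lbrakk>\<And>j. j < k \<Longrightarrow> X (Suc j) = A *v X j + B *v U j\<rbrakk> \<Longrightarrow>
           norm (Q (X 0)) \<le> K' * (\<Sum>j\<le>k. norm (C *v X j))"
    using Suc.IH[OF Q] Q0 by blast
  \<comment> \<open>If \<open>f (x, u) = 0\<close>, then C x = 0 and A x + B u lies in
    \<open>W\<^sub>k\<close>; so \<open>x\<close> lies in \<open>W\<^sub>k\<^sub>+\<^sub>1\<close>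
    and \<open>g x = 0\<close>. The kernel inclusion bounds \<open>g (X 0)\<close> by
    \<open>C *v X 0\<close> and \<open>Q (X 1)\<close>, and the shifted sequence bounds the
    latter.\<close>
  define f where "f = (\<lambda>(x, u). (C *v x, Q (A *v x + B *v u)))"
  have "linear f"
    unfolding f_def using linear_add[OF Q] linear_scale[OF Q]
    by (intro linearI)
       (auto simp: matrix_vector_right_distrib matrix_vector_mult_scaleR algebra_simps)
  moreover have "linear (\<lambda>(x, u :: real^'m). g x)"
    using linear_add[OF Suc.prems(1)] linear_scale[OF Suc.prems(1)] by (intro linearI) auto
  moreover have "(case p of (x, u :: real^'m) \<Rightarrow> g x) = 0" if "f p = 0" for p
    using that Q0 by (intro prod.induct[of "\<lambda>p. f p = 0 \<longrightarrow> (case p of (x, u) \<Rightarrow> g x) = 0", THEN mp])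
      (auto simp: f_def zero_prod_def intro!: Suc.prems(2))
  ultimately obtain K where K: "K > 0" "\<And>p. norm (case p of (x, u :: real^'m) \<Rightarrow> g x) \<le> K * norm (f p)"
    by (rule linear_bound_of_kernel_subset) (assumption, rule that, assumption+)
  show ?case
  proof (intro exI[of _ "K * (1 + K')"] conjI allI impI)
    show "0 \<le> K * (1 + K')" using K K' by simp
    fix X U assume X: "\<forall>j<Suc k. X (Suc j) = A *v X j + B *v U j"
    let ?S = "\<Sum>j\<le>k. norm (C *v X (Suc j))"
    have "norm (g (X 0)) \<le> K * norm (C *v X 0, Q (X 1))"
      using K(2)[of "(X 0, U 0)"] X by (simp add: f_def)
    also have "\<dots> \<le> K * (norm (C *v X 0) + norm (Q (X 1)))"
      using K by (intro mult_left_mono norm_Pair_le) auto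
    also have "norm (Q (X 1)) \<le> K' * ?S"
      using IH[of "\<lambda>j. X (Suc j)" "\<lambda>j. U (Suc j)"] X by simp
    also have "K * (norm (C *v X 0) + K' * ?S) \<le> K * ((1 + K') * (norm (C *v X 0) + ?S))"
      using K K' by (intro mult_left_mono) (auto simp: algebra_simps intro!: add_nonneg_nonneg sum_nonneg mult_nonneg_nonneg)
    also have "norm (C *v X 0) + ?S = (\<Sum>j\<le>Suc k. norm (C *v X j))"
      by (subst sum.atMost_Suc_shift) simp
    finally show "norm (g (X 0)) \<le> K * (1 + K') * (\<Sum>j\<le>Suc k. norm (C *v X j))"
      using K by (simp add: mult.assoc)
  qed
qed

text \<open>Modulo the largest output-nulling subspace \<open>S\<close>, the state is a function of the output jet; the
  input is determined up to the feedback \<open>F\<close> since no nonzero \<open>B v\<close> lies in \<open>S\<close>.\<close>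

lemma state_input_bound:
  fixes A :: "real^'n^'n" and B :: "real^'m^'n" and C :: "real^'n^'l" and F :: "real^'n^'m"
    and P :: "real^'n^'n"
  defines "S \<equiv> max_AB_invariant_in_ker A B C"
  assumes li: "left_invertible A B C" and F: "(*v) (A + B ** F) ` S \<subseteq> S"
    and P: "\<And>x. x \<in> S \<Longrightarrow> P *v x = x"
  obtains N K where "N \<ge> 1" "K \<ge> 0"
    "\<And>X U. (\<And>j. j < N \<Longrightarrow> X (Suc j) = A *v X j + B *v U j) \<Longrightarrow>
       norm (X 0 - P *v X 0) \<le> K * (\<Sum>j\<le>N. norm (C *v X j)) \<and>
       norm (U 0 - F *v X 0) \<le> K * (\<Sum>j\<le>N. norm (C *v X j))"
proof -
  obtain k where k: "output_nulling A B C (Suc k) = output_nulling A B C k"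
    using output_nulling_stabilises by blast
  define W where "W = output_nulling A B C k"
  have WS: "W \<subseteq> S" using output_nulling_fixpoint_subset[OF k] by (simp add: W_def S_def)
  have S: "subspace S" "S \<subseteq> {x. C *v x = 0}"
    using max_AB_invariant_in_ker_greatest(1)[of A B C] by (auto simp: S_def AB_invariant_def)
  obtain R where R: "\<And>x. R *v x \<in> W" "\<And>x. x \<in> W \<Longrightarrow> R *v x = x"
    using subspace_projection[of W] subspace_output_nulling W_def by blast
  define Q where "Q x = x - R *v x" for x
  have Q: "linear Q" unfolding Q_def
    by (intro linear_compose_sub linear_ident matrix_vector_mul_linear)
  have Q0: "Q x = 0 \<longleftrightarrow> x \<in> W" for x using R[of x] by (auto simp: Q_def)
  let ?jet = "\<lambda>k X U. \<forall>j<k. X (Suc j) = A *v X j + B *v U j"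
  let ?Y = "\<lambda>k X. \<Sum>j\<le>k. norm (C *v X j)"
  have "linear (\<lambda>x. x - P *v x)"
    by (intro linear_compose_sub linear_ident matrix_vector_mul_linear)
  then obtain K1 where K1: "K1 \<ge> 0" "\<And>X U. ?jet k X U \<Longrightarrow> norm (X 0 - P *v X 0) \<le> K1 * ?Y k X"
    using output_jet_bound[of "\<lambda>x. x - P *v x" A B C k] WS P W_def by fastforce
  obtain K2 where K2: "K2 \<ge> 0" "\<And>X U. ?jet k X U \<Longrightarrow> norm (Q (X 0)) \<le> K2 * ?Y k X"
    using output_jet_bound[OF Q, of A B C k] Q0 W_def by blast
  \<comment> \<open>A zero of \<open>f\<close> has both x and A x + B u in \<open>W\<close>, hence
    in \<open>S\<close>. Subtracting (A + BF) x, also in \<open>S\<close>, leaves B (u - F x) in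
    \<open>S\<close>.\<close>
  define f where "f = (\<lambda>(x, u). (Q x, Q (A *v x + B *v u)))"
  define g where "g = (\<lambda>(x, u). u - F *v x)"
  have "linear f"
    unfolding f_def using linear_add[OF Q] linear_scale[OF Q]
    by (intro linearI)
       (auto simp: matrix_vector_right_distrib matrix_vector_mult_scaleR algebra_simps)
  moreover have "linear g"
    unfolding g_def
    by (intro linearI)
       (auto simp: matrix_vector_right_distrib matrix_vector_mult_scaleR algebra_simps)
  moreover have "g p = 0" if "f p = 0" for p
  proof -
    obtain x u where p: "p = (x, u)" by fastforce
    have x: "x \<in> S" "A *v x + B *v u \<in> S" using that Q0 WS by (auto simp: p f_def zero_prod_def)
    moreover have "(A + B ** F) *v x \<in> S" using F x by blast
    ultimately have "(A *v x + B *v u) - (A + B ** F) *v x \<in> S" using subspace_diff[OF S(1)] by blast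
    then have "B *v (u - F *v x) \<in> S"
      by (simp add: matrix_vector_mult_add_rdistrib matrix_vector_mult_diff_distrib
          matrix_vector_mul_assoc)
    then have "u - F *v x = 0" by (rule left_invertible_range_Int[OF li S(1) F S(2)])
    then show ?thesis by (simp add: p g_def)
  qed
  ultimately obtain K3 where K3: "K3 > 0" "\<And>p. norm (g p) \<le> K3 * norm (f p)"
    by (rule linear_bound_of_kernel_subset) (assumption, rule that, assumption+)
  show ?thesis
  \<comment> \<open>Order \<open>Suc k\<close> because the input bound involves
    \<open>Q (X 1)\<close>, whose output jet is shifted by one. In the constant, \<open>K1\<close>
    serves the state, and \<open>2 * K3 * K2\<close> serves the input, one \<open>K2\<close> for
    each component of \<open>f\<close>.\<close>
  proof (rule that[of "Suc k" "K1 + 2 * K3 * K2"])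
    fix X U assume X: "\<And>j. j < Suc k \<Longrightarrow> X (Suc j) = A *v X j + B *v U j"
    have Y: "?Y k X \<le> ?Y (Suc k) X" "0 \<le> ?Y (Suc k) X"
      by (auto intro!: sum_nonneg add_nonneg_nonneg)
    have Y': "?Y k (\<lambda>j. X (Suc j)) \<le> ?Y (Suc k) X"
      by (simp add: sum.atMost_Suc_shift del: sum.atMost_Suc)
    have "norm (U 0 - F *v X 0) \<le> K3 * norm (Q (X 0), Q (X 1))"
      using K3(2)[of "(X 0, U 0)"] X[of 0] by (simp add: f_def g_def)
    also have "\<dots> \<le> K3 * (norm (Q (X 0)) + norm (Q (X 1)))"
      using K3 by (intro mult_left_mono norm_Pair_le) auto
    also have "\<dots> \<le> K3 * (K2 * ?Y (Suc k) X + K2 * ?Y (Suc k) X)"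
    proof (intro mult_left_mono add_mono)
      have "norm (Q (X 0)) \<le> K2 * ?Y k X" using K2(2)[of X U] X by simp
      then show "norm (Q (X 0)) \<le> K2 * ?Y (Suc k) X"
        using mult_left_mono[OF Y(1) K2(1)] by linarith
      have "norm (Q (X 1)) \<le> K2 * ?Y k (\<lambda>j. X (Suc j))"
        using K2(2)[of "\<lambda>j. X (Suc j)" "\<lambda>j. U (Suc j)"] X by simp
      then show "norm (Q (X 1)) \<le> K2 * ?Y (Suc k) X"
        using mult_left_mono[OF Y' K2(1)] by linarith
    qed (use K3 in auto)
    also have "\<dots> \<le> (K1 + 2 * K3 * K2) * ?Y (Suc k) X"
      using mult_nonneg_nonneg[OF K1(1) Y(2)] by (simp add: algebra_simps)
    finally have "norm (U 0 - F *v X 0) \<le> (K1 + 2 * K3 * K2) * ?Y (Suc k) X" .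
    moreover have "norm (X 0 - P *v X 0) \<le> K1 * ?Y (Suc k) X"
      using K1(2)[of X U] X mult_left_mono[OF Y(1) K1(1)] by fastforce
    moreover have "K1 * ?Y (Suc k) X \<le> (K1 + 2 * K3 * K2) * ?Y (Suc k) X"
      using Y(2) K2(1) K3(1) by (intro mult_right_mono) auto
    ultimately show "norm (X 0 - P *v X 0) \<le> (K1 + 2 * K3 * K2) * ?Y (Suc k) X \<and>
        norm (U 0 - F *v X 0) \<le> (K1 + 2 * K3 * K2) * ?Y (Suc k) X" by linarith
  qed (use K1 K2 K3 in auto)
qed

section \<open>Stable linear differential equations\<close>

lemma euclidean_dependent_sequence:
  fixes a :: "nat \<Rightarrow> 'a::euclidean_space"
  shows "\<exists>c. (\<exists>i\<le>DIM('a). c i \<noteq> 0) \<and> (\<Sum>i\<le>DIM('a). c i *\<^sub>R a i) = 0"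
\<comment> \<open>Linear dependence of a set does not see repetitions, so a repeated vector is
  handled separately, with coefficients 1 and -1.\<close>
proof (cases "inj_on a {..DIM('a)}")
  case True
  have "dependent (a ` {..DIM('a)})"
    by (rule dependent_biggerset) (simp add: card_image[OF True])
  then obtain u where u: "\<exists>v\<in>a ` {..DIM('a)}. u v \<noteq> 0" "(\<Sum>v\<in>a ` {..DIM('a)}. u v *\<^sub>R v) = 0"
    unfolding dependent_finite[OF finite_imageI[OF finite_atMost]] by blast
  show ?thesis
    by (rule exI[of _ "\<lambda>i. u (a i)"]) (use u sum.reindex[OF True, of "\<lambda>v. u v *\<^sub>R v"] in \<open>auto simp: o_def\<close>)
next
  case False
  then obtain i j where ij: "i \<le> DIM('a)" "j \<le> DIM('a)" "i \<noteq> j" "a i = a j"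
    by (auto simp: inj_on_def)
  define c :: "nat \<Rightarrow> real" where "c k = (if k = i then 1 else 0) - (if k = j then 1 else 0)" for k
  have "(\<Sum>k\<le>DIM('a). c k *\<^sub>R a k)
      = (\<Sum>k\<le>DIM('a). if k = i then a k else 0) - (\<Sum>k\<le>DIM('a). if k = j then a k else 0)"
    unfolding sum_subtractf[symmetric] by (rule sum.cong) (auto simp: c_def)
  also have "\<dots> = 0" using ij by (simp only: sum.delta finite_atMost) simp
  finally show ?thesis
    using ij by (intro exI[of _ c] conjI exI[of _ i]) (simp_all add: c_def)
qed

text \<open>The product of the factors \<open>G - \<mu>\<close> applied to \<open>v\<close>. The
  head acts first, so removing it from the list replaces \<open>v\<close> by (G - \<mu>) v; this is
  the form needed for induction along a solution.\<close>

fun shift_prod :: "'a::comm_ring_1^'n^'n \<Rightarrow> 'a list \<Rightarrow> 'a^'n \<Rightarrow> 'a^'n" where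
  "shift_prod G [] v = v"
| "shift_prod G (\<mu> # ms) v = shift_prod G ms (G *v v - \<mu> *s v)"

lemma shift_prod_commute:
  fixes G :: "'a::field^'n^'n"
  shows "shift_prod G ms (G *v v - \<mu> *s v) = G *v shift_prod G ms v - \<mu> *s shift_prod G ms v"
proof (induction ms arbitrary: v)
  case (Cons \<nu> ms)
  have "G *v (G *v v - \<mu> *s v) - \<nu> *s (G *v v - \<mu> *s v)
      = G *v (G *v v - \<nu> *s v) - \<mu> *s (G *v v - \<nu> *s v)"
    by (simp add: matrix_vector_mult_diff_distrib vector_scalar_commute vec.scale_right_diff_distrib
        mult.commute)
  then show ?case by (simp only: shift_prod.simps Cons.IH)
qed simp

text \<open>The factors commute, so any one can be moved outermost. If \<open>\<mu>\<close> is not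
  an eigenvalue, \<open>G - \<mu>\<close> is injective and can be cancelled.\<close>

lemma shift_prod_filter_eigenvalues:
  fixes G :: "'a::field^'n^'n"
  assumes "shift_prod G ms v = 0"
  shows "shift_prod G (filter (\<lambda>\<mu>. \<exists>z. z \<noteq> 0 \<and> G *v z = \<mu> *s z) ms) v = 0"
  using assms
proof (induction ms arbitrary: v)
  case (Cons \<mu> ms)
  show ?case
  proof (cases "\<exists>z. z \<noteq> 0 \<and> G *v z = \<mu> *s z")
    case True
    then show ?thesis using Cons by simp
  next
    case False
    have "G *v shift_prod G ms v = \<mu> *s shift_prod G ms v"
      using Cons.prems by (simp add: shift_prod_commute)
    then have "shift_prod G ms v = 0" using False by blast
    then show ?thesis using Cons.IH False by auto
  qed
qed simp

lemma degree_prod_list_linear_factors: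
  "degree (prod_list (map (\<lambda>\<mu>::'a::idom. [:- \<mu>, 1:]) ms)) = length ms"
  by (induction ms) (simp_all add: degree_mult_eq prod_list_zero_iff image_iff del: mult_pCons_left)

lemma shift_prod_conv_sum:
  fixes G :: "'a::field^'n^'n"
  shows "shift_prod G ms v =
    (\<Sum>i\<le>length ms. coeff (prod_list (map (\<lambda>\<mu>. [:- \<mu>, 1:]) ms)) i *s (((*v) G ^^ i) v))"
proof (induction ms arbitrary: v)
  case (Cons \<mu> ms)
  define p where "p = prod_list (map (\<lambda>\<mu>. [:- \<mu>, 1:]) ms)"
  let ?N = "length ms" and ?G = "\<lambda>i. (*v) G ^^ i"
  have deg: "coeff p (Suc ?N) = 0"
    using degree_prod_list_linear_factors[of ms] by (simp add: p_def coeff_eq_0)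
  have lin: "?G i (G *v v - \<mu> *s v) = ?G (Suc i) v - \<mu> *s ?G i v" for i
    by (induction i) (simp_all add: matrix_vector_mult_diff_distrib vector_scalar_commute)
  have "(\<Sum>i\<le>Suc ?N. coeff ([:- \<mu>, 1:] * p) i *s ?G i v)
      = (\<Sum>i\<le>Suc ?N. coeff (pCons 0 p) i *s ?G i v) - (\<Sum>i\<le>Suc ?N. (coeff p i * \<mu>) *s ?G i v)"
    by (simp only: sum_subtractf[symmetric] vec.scale_left_diff_distrib[symmetric])
       (intro sum.cong refl, simp add: mult.commute)
  also have "(\<Sum>i\<le>Suc ?N. coeff (pCons 0 p) i *s ?G i v) = (\<Sum>i\<le>?N. coeff p i *s ?G (Suc i) v)"
    by (subst sum.atMost_Suc_shift) simp
  also have "(\<Sum>i\<le>Suc ?N. (coeff p i * \<mu>) *s ?G i v) = (\<Sum>i\<le>?N. (coeff p i * \<mu>) *s ?G i v)"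
    by (simp add: deg)
  also have "(\<Sum>i\<le>?N. coeff p i *s ?G (Suc i) v) - \<dots> = (\<Sum>i\<le>?N. coeff p i *s ?G i (G *v v - \<mu> *s v))"
    by (simp only: lin sum_subtractf[symmetric] vec.scale_right_diff_distrib vec.scale_scale)
  also have "\<dots> = shift_prod G (\<mu> # ms) v" by (simp add: Cons.IH p_def)
  finally show ?case by (simp add: p_def del: mult_pCons_left)
qed simp

text \<open>The powers of \<open>G\<close> are linearly dependent in the space of matrices. The
  resulting polynomial splits over the complex numbers, and its roots that are not eigenvalues are
  discarded.\<close>

lemma shift_prod_annihilating:
  fixes G :: "complex^'n^'n"
  obtains ms where "\<And>v. shift_prod G ms v = 0" "\<And>\<mu>. \<mu> \<in> set ms \<Longrightarrow> \<exists>z. z \<noteq> 0 \<and> G *v z = \<mu> *s z"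
proof -
  define Q where "Q i = ((**) G ^^ i) (mat 1)" for i
  have Q: "Q i *v v = ((*v) G ^^ i) v" for i v
    by (induction i) (simp_all add: Q_def matrix_vector_mul_assoc[symmetric])
  \<comment> \<open>\<open>DIM\<close> is the real dimension, so the coefficients \<open>c\<close>
    of the dependence are real and have to be embedded into the complex numbers.\<close>
  let ?N = "DIM(complex^'n^'n)"
  obtain c where c: "\<exists>i\<le>?N. c i \<noteq> 0" "(\<Sum>i\<le>?N. c i *\<^sub>R Q i) = 0"
    using euclidean_dependent_sequence[of Q] by blast
  have c0: "(\<Sum>i\<le>?N. complex_of_real (c i) *s (((*v) G ^^ i) v)) = 0" for v
  proof -
    have "(\<Sum>i\<le>?N. complex_of_real (c i) *s (((*v) G ^^ i) v)) = (\<Sum>i\<le>?N. (c i *\<^sub>R Q i) *v v)"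
      by (intro sum.cong refl)
         (simp only: Q[symmetric], simp add: vec_eq_iff matrix_vector_mult_def scaleR_conv_of_real[where 'a=complex]
           sum_distrib_left mult.assoc)
    also have "\<dots> = (\<Sum>i\<le>?N. c i *\<^sub>R Q i) *v v"
      by (simp add: vec_eq_iff matrix_vector_mult_def sum_distrib_right, intro allI sum.swap)
    finally show ?thesis by (simp only: c(2) matrix_vector_mult_0)
  qed
  define p where "p = (\<Sum>i\<le>?N. monom (complex_of_real (c i)) i)"
  have cp: "coeff p i = (if i \<le> ?N then complex_of_real (c i) else 0)" for i
    by (simp add: p_def coeff_sum)
  have "p \<noteq> 0" using c(1) cp by (metis coeff_0 of_real_eq_0_iff)
  then obtain M where M: "size M = degree p" "p = smult (lead_coeff p) (\<Prod>x\<in>#M. [:-x, 1:])"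
    using alg_closed_imp_factorization[OF \<open>p \<noteq> 0\<close>] by blast
  obtain ms where ms: "mset ms = M" using ex_mset by blast
  have len: "length ms = degree p" using M(1) ms by (metis size_mset)
  have p: "p = smult (lead_coeff p) (prod_list (map (\<lambda>\<mu>. [:- \<mu>, 1:]) ms))"
    using M(2) unfolding ms[symmetric] mset_map[symmetric] prod_mset_prod_list .
  have deg: "degree p \<le> ?N" by (rule degree_le) (simp add: cp)
  have ann: "shift_prod G ms v = 0" for v
  proof -
    have "lead_coeff p *s shift_prod G ms v = (\<Sum>i\<le>length ms. coeff p i *s (((*v) G ^^ i) v))"
      by (subst (2) p) (simp add: shift_prod_conv_sum vec.scale_sum_right)
    also have "\<dots> = (\<Sum>i\<le>?N. coeff p i *s (((*v) G ^^ i) v))"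
      by (rule sum.mono_neutral_left) (use deg in \<open>auto simp: len coeff_eq_0\<close>)
    also have "\<dots> = 0" using c0[of v] by (simp add: cp)
    finally show ?thesis using \<open>p \<noteq> 0\<close> by simp
  qed
  show ?thesis
    by (rule that[of "filter (\<lambda>\<mu>. \<exists>z. z \<noteq> 0 \<and> G *v z = \<mu> *s z) ms"])
       (use shift_prod_filter_eigenvalues ann in auto)
qed

section \<open>Decay estimates for linear equations\<close>

lemma norm_vector_scalar_mult: "norm (c *s v) = norm c * norm v"
  for c :: "'a::real_normed_field"
  by (simp add: norm_vec_def norm_mult L2_set_right_distrib)

lemma bounded_bilinear_vector_scalar_mult:
  "bounded_bilinear ((*s) :: 'a::real_normed_field \<Rightarrow> 'a^'n \<Rightarrow> 'a^'n)"
proof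
  show "\<exists>K. \<forall>(a::'a) (b::'a^'n). norm (a *s b) \<le> norm a * norm b * K"
    by (rule exI[of _ 1]) (simp add: norm_vector_scalar_mult)
qed (auto simp: vec_eq_iff algebra_simps)

lemma bounded_linear_matrix_vector_mult:
  "bounded_linear ((*v) (G :: 'a::{real_normed_field,euclidean_space}^'n^'m))"
  by (intro linear_conv_bounded_linear[THEN iffD1] linearI)
     (rule matrix_vector_right_distrib, simp add: vec_eq_iff matrix_vector_mult_def scaleR_sum_right)

text \<open>The integrating factor exp(-\<mu> t) removes the linear term. The strict inequality
  \<open>a < b\<close> keeps the convolution of exp(-b t) with exp(-a t) below exp(-a t) / (b - a);
  at a = b a factor t would appear.\<close>

lemma scalar_mode_bound:
  fixes z w :: "real \<Rightarrow> complex^'n"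
  assumes z: "\<And>t. t \<in> {0..T} \<Longrightarrow> (z has_vector_derivative (\<mu> *s z t + w t)) (at t within {0..T})"
    and w: "\<And>t. t \<in> {0..T} \<Longrightarrow> norm (w t) \<le> \<alpha> * exp (- a * t) + \<delta>"
    and ab: "0 < a" "a < b" "b = - Re \<mu>" and nn: "0 \<le> \<alpha>" "0 \<le> \<delta>"
    and t: "t \<in> {0..T}"
  shows "norm (z t) \<le> exp (- b * t) * norm (z 0) + \<alpha> / (b - a) * exp (- a * t) + \<delta> / b"
proof (cases "t = 0")
  case True
  have "b > 0" using ab by linarith
  then have "0 \<le> \<alpha> / (b - a)" "0 \<le> \<delta> / b"
    using ab(2) nn by (auto intro: divide_nonneg_pos)
  then show ?thesis using True by simp
next
  case False
  with t have t0: "0 < t" "t \<le> T" by auto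
  define r where "r s = exp (- of_real s * \<mu>) *s z s" for s
  \<comment> \<open>An antiderivative of \<alpha> exp((b - a) s) + \<delta> exp(b s), the bound on
    the derivative of \<open>r\<close>.\<close>
  define \<phi> where "\<phi> s = \<alpha> / (b - a) * exp ((b - a) * s) + \<delta> / b * exp (b * s)" for s
  have r': "(r has_vector_derivative (exp (- of_real s * \<mu>) *s w s)) (at s within {0..T})"
    if "s \<in> {0..T}" for s
  proof -
    have "((\<lambda>s. exp (- complex_of_real s * \<mu>)) has_vector_derivative (- \<mu> * exp (- complex_of_real s * \<mu>)))
        (at s within {0..T})"
      by (rule has_vector_derivative_real_field[where f = "\<lambda>c. exp (- c * \<mu>)"])
         (auto intro!: derivative_eq_intros)
    from bounded_bilinear.has_vector_derivative[OF bounded_bilinear_vector_scalar_mult this z[OF that]]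
    show ?thesis unfolding r_def
      by (rule has_vector_derivative_eq_rhs)
         (simp add: vec.scale_right_distrib mult.commute vec_eq_iff algebra_simps)
  qed
  have "norm (r t - r 0) \<le> \<phi> t - \<phi> 0"
  proof (rule differentiable_bound_general[OF t0(1)])
    have "continuous_on {0..T} r"
      using r' has_vector_derivative_continuous continuous_on_eq_continuous_within by blast
    then show "continuous_on {0..t} r" by (rule continuous_on_subset) (use t0 in auto)
    show "continuous_on {0..t} \<phi>" unfolding \<phi>_def by (intro continuous_intros)
    fix s assume s: "0 < s" "s < t"
    show "(r has_vector_derivative (exp (- of_real s * \<mu>) *s w s)) (at s)"
      using r'[of s] s t0 by (simp add: at_within_Icc_at)
    show "(\<phi> has_vector_derivative (\<alpha> * exp ((b - a) * s) + \<delta> * exp (b * s))) (at s)"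
      unfolding \<phi>_def using ab
      by (auto intro!: derivative_eq_intros simp: has_real_derivative_iff_has_vector_derivative[symmetric])
    have "norm (exp (- of_real s * \<mu>) *s w s) = exp (b * s) * norm (w s)"
      by (simp add: norm_vector_scalar_mult ab mult.commute)
    also have "\<dots> \<le> exp (b * s) * (\<alpha> * exp (- a * s) + \<delta>)"
      using w[of s] s t0 by (intro mult_left_mono) auto
    also have "\<dots> = \<alpha> * exp ((b - a) * s) + \<delta> * exp (b * s)"
      by (simp add: algebra_simps exp_add[symmetric] exp_diff)
    finally show "norm (exp (- of_real s * \<mu>) *s w s) \<le> \<alpha> * exp ((b - a) * s) + \<delta> * exp (b * s)" .
  qed
  moreover have "b > 0" using ab by linarith
  then have "0 \<le> \<phi> 0" unfolding \<phi>_def using ab(2) nn by (auto intro!: add_nonneg_nonneg divide_nonneg_pos)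
  moreover have "norm (r t) \<le> norm (r 0) + norm (r t - r 0)" by norm
  ultimately have "norm (r t) \<le> norm (z 0) + \<phi> t" by (simp add: r_def)
  moreover have "norm (r t) = exp (b * t) * norm (z t)"
    by (simp add: r_def norm_vector_scalar_mult ab mult.commute)
  ultimately have e0: "exp (- b * t) * (exp (b * t) * norm (z t)) \<le> exp (- b * t) * (norm (z 0) + \<phi> t)"
    by (intro mult_left_mono) auto
  have e1: "exp (- b * t) * exp (b * t) = 1" by (simp flip: exp_add)
  then have e3: "exp (- b * t) * (exp (b * t) * norm (z t)) = norm (z t)"
    by (simp add: mult.assoc[symmetric])
  have e2: "exp (- b * t) * exp ((b - a) * t) = exp (- a * t)"
    by (simp add: algebra_simps flip: exp_add)
  have e4: "exp (- b * t) * (norm (z 0) + \<phi> t) = exp (- b * t) * norm (z 0)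
      + \<alpha> / (b - a) * (exp (- b * t) * exp ((b - a) * t)) + \<delta> / b * (exp (- b * t) * exp (b * t))"
    unfolding \<phi>_def by (simp only: distrib_left mult_ac add_ac)
  show ?thesis using e0 unfolding e3 e4 e1 e2 by simp
qed

text \<open>Induction on the annihilating product: \<open>w = (G - \<mu>) z\<close> obeys the same equation with a shorter
  product, and \<open>z' = \<mu> z + w + d\<close>.\<close>

lemma annihilated_solution_bound:
  fixes G :: "complex^'n^'n"
  assumes "\<And>\<mu>. \<mu> \<in> set ms \<Longrightarrow> Re \<mu> < 0"
  shows "\<exists>K a. K \<ge> 0 \<and> a > 0 \<and> (\<forall>z d T D.
    (\<forall>t\<in>{0..T}. (z has_vector_derivative (G *v z t + d t)) (at t within {0..T}) \<and>
       norm (d t) \<le> D \<and> shift_prod G ms (z t) = 0) \<longrightarrow>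
    (\<forall>t\<in>{0..T}. norm (z t) \<le> K * (exp (- a * t) * norm (z 0) + D)))"
  using assms
proof (induction ms)
  \<comment> \<open>The empty product is the identity, so the solution vanishes.\<close>
  case Nil
  show ?case by (intro exI[of _ 0] exI[of _ 1]) auto
next
  case (Cons \<mu> ms)
  obtain K' a' where K': "K' \<ge> 0" "a' > 0" and IH: "\<And>z d T D t.
    (\<And>t. t\<in>{0..T} \<Longrightarrow> (z has_vector_derivative (G *v z t + d t)) (at t within {0..T}) \<and>
       norm (d t) \<le> D \<and> shift_prod G ms (z t) = 0) \<Longrightarrow> t\<in>{0..T} \<Longrightarrow>
    norm (z t) \<le> K' * (exp (- a' * t) * norm (z 0) + D)"
    using Cons by (metis list.set_intros(2))
  define b where "b = - Re \<mu>"
  have b: "b > 0" using Cons.prems[of \<mu>] by (simp add: b_def)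
  \<comment> \<open>Halving makes the rate strictly smaller than \<open>b\<close>, as the scalar
    estimate demands, while keeping it at most \<open>a'\<close>.\<close>
  define a where "a = min a' b / 2"
  have a: "0 < a" "a < b" "a \<le> a'" using b K' by (auto simp: a_def min_def)
  define H where "H v = G *v v - \<mu> *s v" for v
  have H: "bounded_linear H" unfolding H_def
    by (intro bounded_linear_sub bounded_linear_matrix_vector_mult
        bounded_bilinear.bounded_linear_right[OF bounded_bilinear_vector_scalar_mult])
  then obtain L where L: "L > 0" "\<And>v. norm (H v) \<le> norm v * L"
    using bounded_linear.pos_bounded by blast
  \<comment> \<open>The summands come from the homogeneous solution, the decaying part of
    \<open>H (z s)\<close>, and the bounded part of the forcing; in the last one, + 1 accounts for
    \<open>d\<close> itself.\<close>
  define K where "K = 1 + K' * L / (b - a) + (K' * L + 1) / b"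
  show ?case
  proof (rule exI[of _ K], rule exI[of _ a], intro conjI allI impI ballI)
    show "K \<ge> 0" "a > 0" using a b K' L by (auto simp: K_def intro!: add_nonneg_nonneg)
    fix z :: "real \<Rightarrow> complex^'n" and d T D t
    assume z: "\<forall>t\<in>{0..T}. (z has_vector_derivative (G *v z t + d t)) (at t within {0..T}) \<and>
       norm (d t) \<le> D \<and> shift_prod G (\<mu> # ms) (z t) = 0" and t: "t \<in> {0..T}"
    have "0 \<in> {0..T}" using t by auto
    then have "norm (d 0) \<le> D" using z by blast
    then have D: "D \<ge> 0" using norm_ge_zero order_trans by blast
    have w: "norm (H (z s)) \<le> K' * (exp (- a' * s) * norm (H (z 0)) + L * D)" if s: "s \<in> {0..T}" for s
    proof (rule IH[where d = "\<lambda>s. H (d s)" and T = T, OF _ s])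
      fix s assume s: "s \<in> {0..T}"
      have "((\<lambda>s. H (z s)) has_vector_derivative H (G *v z s + d s)) (at s within {0..T})"
        using z s by (intro bounded_linear.has_vector_derivative[OF H]) blast
      also have "H (G *v z s + d s) = G *v H (z s) + H (d s)"
        by (simp add: H_def matrix_vector_mult_diff_distrib matrix_vector_right_distrib
            vector_scalar_commute vec.scale_right_distrib)
      finally have "((\<lambda>s. H (z s)) has_vector_derivative (G *v H (z s) + H (d s))) (at s within {0..T})" .
      moreover have "norm (H (d s)) \<le> L * D"
        using L(2)[of "d s"] z s L(1) by (smt (verit) mult.commute mult_left_mono)
      moreover have "shift_prod G ms (H (z s)) = 0" using z s by (simp add: H_def)
      ultimately show "((\<lambda>s. H (z s)) has_vector_derivative (G *v H (z s) + H (d s))) (at s within {0..T})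
         \<and> norm (H (d s)) \<le> L * D \<and> shift_prod G ms (H (z s)) = 0" by blast
    qed
    have "norm (z t) \<le> exp (- b * t) * norm (z 0) + (K' * L * norm (z 0)) / (b - a) * exp (- a * t)
        + (K' * L + 1) * D / b"
    proof (rule scalar_mode_bound[where w = "\<lambda>s. H (z s) + d s" and \<mu> = \<mu> and T = T])
      fix s assume s: "s \<in> {0..T}"
      show "(z has_vector_derivative (\<mu> *s z s + (H (z s) + d s))) (at s within {0..T})"
        using z s by (simp add: H_def)
      have "exp (- a' * s) * norm (H (z 0)) \<le> exp (- a * s) * (L * norm (z 0))"
        using a(3) s L(2)[of "z 0"] by (intro mult_mono) (auto simp: mult.commute mult_right_mono)
      then have "K' * (exp (- a' * s) * norm (H (z 0)) + L * D) \<le> K' * (exp (- a * s) * (L * norm (z 0)) + L * D)"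
        using K' by (intro mult_left_mono) auto
      then have "norm (H (z s)) \<le> K' * (exp (- a * s) * (L * norm (z 0)) + L * D)"
        using w[OF s] by linarith
      moreover have "norm (d s) \<le> D" using z s by blast
      ultimately show "norm (H (z s) + d s) \<le> K' * L * norm (z 0) * exp (- a * s) + (K' * L + 1) * D"
        using norm_triangle_ineq[of "H (z s)" "d s"] by (simp add: algebra_simps)
    qed (use a b_def D K' L t in auto)
    moreover have "exp (- b * t) * norm (z 0) \<le> exp (- a * t) * norm (z 0)"
      using a t by (intro mult_right_mono) (auto intro: mult_right_mono)
    ultimately have "norm (z t) \<le> (1 + K' * L / (b - a)) * (exp (- a * t) * norm (z 0)) + ((K' * L + 1) / b) * D"
      by (simp add: algebra_simps)
    also have "\<dots> \<le> K * (exp (- a * t) * norm (z 0)) + K * D"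
      using a b K' L D by (intro add_mono mult_right_mono) (auto simp: K_def)
    finally show "norm (z t) \<le> K * (exp (- a * t) * norm (z 0) + D)" by (simp add: algebra_simps)
  qed
qed

text \<open>The entrywise embedding \<open>cv\<close> into complex vectors preserves norms, so the
  complex estimate carries over. \<open>K\<close> and \<open>a\<close> are fixed before
  \<open>T\<close> and \<open>D\<close>: later \<open>D\<close> is a multiple of the essential
  supremum on {0..T}, which varies with \<open>T\<close>.\<close>

lemma hurwitz_solution_bound:
  fixes G :: "real^'n^'n"
  assumes hurwitz: "\<And>\<mu> v. v \<noteq> 0 \<Longrightarrow> map_matrix complex_of_real G *v v = \<mu> *s v \<Longrightarrow> Re \<mu> < 0"
  obtains K a where "K \<ge> 0" "a > 0" "\<And>z d T D t.
    (\<And>t. t\<in>{0..T} \<Longrightarrow> (z has_vector_derivative (G *v z t + d t)) (at t within {0..T})) \<Longrightarrow>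
    (\<And>t. t\<in>{0..T} \<Longrightarrow> norm (d t) \<le> D) \<Longrightarrow> t\<in>{0..T} \<Longrightarrow>
    norm (z t) \<le> K * (exp (- a * t) * norm (z 0) + D)"
proof -
  define cv :: "real^'n \<Rightarrow> complex^'n" where "cv v = (\<chi> i. complex_of_real (v $ i))" for v
  have ncv: "norm (cv v) = norm v" for v by (simp add: cv_def norm_vec_def)
  have cv: "bounded_linear cv"
    by (rule bounded_linear_intro[of _ 1]) (auto simp: ncv, auto simp: cv_def vec_eq_iff scaleR_conv_of_real[where 'a=complex])
  define Gc where "Gc = map_matrix complex_of_real G"
  have cvG: "cv (G *v v) = Gc *v cv v" for v
    by (simp add: cv_def Gc_def vec_eq_iff matrix_vector_mult_def)
  obtain ms where ms: "\<And>v. shift_prod Gc ms v = 0" "\<And>\<mu>. \<mu> \<in> set ms \<Longrightarrow> \<exists>z. z \<noteq> 0 \<and> Gc *v z = \<mu> *s z"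
    using shift_prod_annihilating by blast
  have "\<And>\<mu>. \<mu> \<in> set ms \<Longrightarrow> Re \<mu> < 0" using ms(2) hurwitz unfolding Gc_def by blast
  then obtain K a where K: "K \<ge> 0" "a > 0" and bd: "\<And>z d T D t.
    (\<And>t. t\<in>{0..T} \<Longrightarrow> (z has_vector_derivative (Gc *v z t + d t)) (at t within {0..T}) \<and>
       norm (d t) \<le> D \<and> shift_prod Gc ms (z t) = 0) \<Longrightarrow> t\<in>{0..T} \<Longrightarrow>
    norm (z t) \<le> K * (exp (- a * t) * norm (z 0) + D)"
    using annihilated_solution_bound[of ms Gc] by metis
  show ?thesis
  proof (rule that[OF K])
    fix z :: "real \<Rightarrow> real^'n" and d T D t
    assume z: "\<And>t. t\<in>{0..T} \<Longrightarrow> (z has_vector_derivative (G *v z t + d t)) (at t within {0..T})"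
      and d: "\<And>t. t\<in>{0..T} \<Longrightarrow> norm (d t) \<le> D" and t: "t\<in>{0..T}"
    have "norm (cv (z t)) \<le> K * (exp (- a * t) * norm (cv (z 0)) + D)"
    proof (rule bd[where d = "\<lambda>t. cv (d t)", OF _ t])
      fix t assume t: "t \<in> {0..T}"
      have "cv (G *v z t + d t) = Gc *v cv (z t) + cv (d t)"
        by (simp add: bounded_linear.linear[OF cv] linear_add cvG)
      then show "((\<lambda>t. cv (z t)) has_vector_derivative (Gc *v cv (z t) + cv (d t))) (at t within {0..T}) \<and>
         norm (cv (d t)) \<le> D \<and> shift_prod Gc ms (cv (z t)) = 0"
        using bounded_linear.has_vector_derivative[OF cv z[OF t]] d[OF t] ms(1) by (simp add: ncv)
    qed
    then show "norm (z t) \<le> K * (exp (- a * t) * norm (z 0) + D)" by (simp add: ncv)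
  qed
qed

section \<open>Derivatives of signals and the essential supremum\<close>

lemma has_vector_derivative_matrix_vector_mult:
  fixes M :: "real^'a^'b"
  assumes "(f has_vector_derivative f') F"
  shows "((\<lambda>t. M *v f t) has_vector_derivative M *v f') F"
  by (rule bounded_linear.has_vector_derivative[OF bounded_linear_matrix_vector_mult assms])

text \<open>Makes derivatives within the half-line unique, including the one-sided one at 0, so that
  \<open>vector_derivative\<close> returns them.\<close>

lemma at_within_halfline_nontrivial: "t \<ge> 0 \<Longrightarrow> at t within {0::real..} \<noteq> bot"
proof -
  assume "t \<ge> 0"
  have ne: "{0::real..} \<noteq> {x}" for x
  proof
    assume "{0::real..} = {x}"
    moreover have "(0::real) \<in> {0..}" "(1::real) \<in> {0..}" by auto
    ultimately show False by simp
  qed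
  have "t islimpt {0..}"
    by (rule connected_imp_perfect[OF _ _ ne]) (use \<open>t \<ge> 0\<close> in \<open>auto intro: convex_connected\<close>)
  then show ?thesis using trivial_limit_within by blast
qed

lemma nth_deriv_0: "nth_deriv 0 z = z"
  by (simp add: nth_deriv_def)

lemma nth_deriv_Suc: "nth_deriv (Suc k) z t = vector_derivative (nth_deriv k z) (at t within {0..})"
  by (simp add: nth_deriv_def)

lemma nth_deriv_SucI:
  assumes "(nth_deriv k z has_vector_derivative d) (at t within {0..})" "t \<ge> 0"
  shows "nth_deriv (Suc k) z t = d"
  unfolding nth_deriv_Suc
  by (rule vector_derivative_within[OF at_within_halfline_nontrivial[OF assms(2)] assms(1)])

text \<open>Differentiating the state equation costs one derivative of \<open>u\<close> each time.
  An input of class C^n thus gives the state n + 1 derivatives, which matches jets of order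
  \<open>N\<close> with inputs of class C^(N-1).\<close>

lemma state_nth_deriv:
  fixes A :: "real^'n^'n" and B :: "real^'m^'n"
  assumes x: "solves A B u x" and u: "cont_differentiable n u" and "k \<le> n" "t \<ge> 0"
  shows "(nth_deriv k x has_vector_derivative (A *v nth_deriv k x t + B *v nth_deriv k u t)) (at t within {0..})"
  using assms(3,4)
proof (induction k arbitrary: t)
  case 0
  then show ?case using x by (simp add: solves_def nth_deriv_0)
next
  case (Suc k)
  have eq: "nth_deriv (Suc k) x s = A *v nth_deriv k x s + B *v nth_deriv k u s" if "s \<in> {0..}" for s
    using nth_deriv_SucI[OF Suc.IH] Suc.prems that by simp
  have xk: "(nth_deriv k x has_vector_derivative nth_deriv (Suc k) x t) (at t within {0..})"
    using Suc.IH[of t] Suc.prems eq[of t] by simp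
  have "nth_deriv k u differentiable (at t within {0..})"
    using u Suc.prems by (simp add: cont_differentiable_def)
  then have uk: "(nth_deriv k u has_vector_derivative nth_deriv (Suc k) u t) (at t within {0..})"
    unfolding nth_deriv_Suc by (rule vector_derivative_works[THEN iffD1])
  show ?case
    by (rule has_vector_derivative_transform[OF _ eq])
       (use Suc.prems in \<open>auto intro!: has_vector_derivative_add
          has_vector_derivative_matrix_vector_mult xk uk\<close>)
qed

lemma output_nth_deriv:
  fixes A :: "real^'n^'n" and B :: "real^'m^'n" and C :: "real^'n^'l"
  assumes x: "solves A B u x" and u: "cont_differentiable n u" and "k \<le> Suc n" "t \<ge> 0"
  shows "nth_deriv k (\<lambda>s. (C *v x s) $ i) t = (C *v nth_deriv k x t) $ i"
  using assms(3,4)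
proof (induction k arbitrary: t)
  case 0
  then show ?case by (simp add: nth_deriv_0)
next
  case (Suc k)
  let ?d = "A *v nth_deriv k x t + B *v nth_deriv k u t"
  have d: "(nth_deriv k x has_vector_derivative ?d) (at t within {0..})"
    using state_nth_deriv[OF x u, of k t] Suc.prems by simp
  have "((\<lambda>s. (C *v nth_deriv k x s) $ i) has_vector_derivative (C *v ?d) $ i) (at t within {0..})"
    by (rule bounded_linear.has_vector_derivative[OF bounded_linear_vec_nth])
       (rule has_vector_derivative_matrix_vector_mult[OF d])
  then have "(nth_deriv k (\<lambda>s. (C *v x s) $ i) has_vector_derivative (C *v ?d) $ i) (at t within {0..})"
    by (rule has_vector_derivative_transform[rotated 2]) (use Suc in auto)
  then show ?case using nth_deriv_SucI[OF d] nth_deriv_SucI Suc.prems by metis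
qed

lemma continuous_on_state_nth_deriv:
  fixes A :: "real^'n^'n" and B :: "real^'m^'n"
  assumes x: "solves A B u x" and u: "cont_differentiable n u" and "k \<le> Suc n"
  shows "continuous_on {0..} (nth_deriv k x)"
proof -
  have c: "continuous_on {0..} (nth_deriv j x)" if "j \<le> n" for j
    unfolding continuous_on_eq_continuous_within
    using state_nth_deriv[OF x u that] has_vector_derivative_continuous by (metis atLeast_iff)
  show ?thesis
  proof (cases "k = Suc n")
    \<comment> \<open>The top derivative need not be differentiable; its continuity is read off from
      the state equation.\<close>
    case True
    have "continuous_on {0..} (\<lambda>t. A *v nth_deriv n x t + B *v nth_deriv n u t)"
      using c[of n] u unfolding cont_differentiable_def
      by (intro continuous_intros bounded_linear.continuous_on[OF bounded_linear_matrix_vector_mult]) auto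
    then show ?thesis unfolding True
      by (rule continuous_on_eq) (use nth_deriv_SucI[OF state_nth_deriv[OF x u]] in auto)
  qed (use assms c in auto)
qed

lemma continuous_on_jet_norm_output:
  fixes A :: "real^'n^'n" and B :: "real^'m^'n" and C :: "real^'n^'l"
  assumes x: "solves A B u x" and u: "cont_differentiable n u"
  shows "continuous_on {0..} (jet_norm (Suc n) (\<lambda>s. C *v x s))"
proof -
  have "continuous_on {0..} (nth_deriv k (\<lambda>s. (C *v x s) $ i))" if "k \<le> Suc n" for k i
  proof -
    have "continuous_on {0..} (\<lambda>t. (C *v nth_deriv k x t) $ i)"
      by (intro continuous_on_component bounded_linear.continuous_on[OF bounded_linear_matrix_vector_mult]
          continuous_on_state_nth_deriv[OF x u that])
    then show ?thesis
      by (rule continuous_on_eq) (use output_nth_deriv[OF x u that, where C = C] in auto)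
  qed
  then show ?thesis unfolding jet_norm_def L2_set_def
    by (auto intro!: continuous_intros simp: case_prod_unfold)
qed

lemma sum_norm_output_le_jet_norm:
  fixes A :: "real^'n^'n" and B :: "real^'m^'n" and C :: "real^'n^'l"
  assumes x: "solves A B u x" and u: "cont_differentiable n u" and t: "t \<ge> 0"
  shows "(\<Sum>k\<le>Suc n. norm (C *v nth_deriv k x t))
     \<le> real (Suc (Suc n)) * real CARD('l) * jet_norm (Suc n) (\<lambda>s. C *v x s) t"
proof -
  let ?J = "jet_norm (Suc n) (\<lambda>s. C *v x s) t"
  have "norm (C *v nth_deriv k x t) \<le> real CARD('l) * ?J" if k: "k \<le> Suc n" for k
  proof -
    have "\<bar>(C *v nth_deriv k x t) $ i\<bar> \<le> ?J" for i
    proof -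
      let ?f = "\<lambda>(i, k). nth_deriv k (\<lambda>s. (C *v x s) $ i) t"
      have "\<bar>?f (i, k)\<bar> \<le> L2_set (\<lambda>p. \<bar>?f p\<bar>) (UNIV \<times> {..Suc n})"
        by (rule member_le_L2_set) (use k in auto)
      also have "\<dots> = ?J" unfolding jet_norm_def L2_set_def by simp
      finally show ?thesis using output_nth_deriv[OF x u k t, where C = C] by simp
    qed
    then have "(\<Sum>i\<in>UNIV. \<bar>(C *v nth_deriv k x t) $ i\<bar>) \<le> real CARD('l) * ?J"
      by (intro sum_bounded_above) auto
    then show ?thesis using norm_le_l1_cart order_trans by blast
  qed
  then have "(\<Sum>k\<le>Suc n. norm (C *v nth_deriv k x t)) \<le> real (card {..Suc n}) * (real CARD('l) * ?J)"
    by (intro sum_bounded_above) auto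
  then show ?thesis by (simp add: mult.assoc)
qed

section \<open>From the essential supremum to pointwise bounds\<close>

lemma le_ess_sup_on:
  assumes g: "continuous_on {a..b} g" and s: "s \<in> {a..b}"
  shows "g s \<le> ess_sup_on a b g"
proof (cases "a < b")
  case False
  then have "s = a" using s by auto
  then show ?thesis using False by (simp add: ess_sup_on_def)
next
  case True
  define E where "E = esssup (lebesgue_on {a..b}) (\<lambda>s. ereal (g s))"
  have meas: "(\<lambda>s. ereal (g s)) \<in> borel_measurable (lebesgue_on {a..b})"
    using continuous_imp_measurable_on_sets_lebesgue[OF g] by simp
  obtain M where "\<forall>y\<in>g ` {a..b}. \<bar>y\<bar> \<le> M"
    using compact_imp_bounded[OF compact_continuous_image[OF g compact_Icc]]
    unfolding bounded_real by blast
  then have M: "\<And>x. x \<in> {a..b} \<Longrightarrow> g x \<le> M" by (auto simp: abs_le_iff)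
  have "E \<le> ereal M" unfolding E_def
    by (rule esssup_I[OF meas]) (auto intro!: AE_I2 M)
  have "AE x in lebesgue_on {a..b}. ereal (g x) \<le> E" unfolding E_def by (rule esssup_AE)
  then have ae: "AE x in lebesgue. x \<in> {a..b} \<longrightarrow> ereal (g x) \<le> E"
    by (subst (asm) AE_restrict_space_iff) auto
  \<comment> \<open>\<open>real_of_ereal\<close> sends infinite values to 0, so finiteness is
    needed. The value minus infinity would make almost every point of a nonempty open interval
    belong to the empty set.\<close>
  have "E \<noteq> - \<infinity>"
  proof
    assume minf: "E = - \<infinity>"
    have "AE x \<in> {a<..<b} in lebesgue. x \<in> {}"
      using ae unfolding minf by eventually_elim auto
    from mem_closed_if_AE_lebesgue_open[OF _ _ this, of "(a + b) / 2"] show False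
      using True by (auto simp: field_simps)
  qed
  with \<open>E \<le> ereal M\<close> obtain r where r: "E = ereal r" by (cases E) auto
  \<comment> \<open>The sublevel set is closed by continuity and contains almost every point of the
    open interval, hence all of them, and then also the endpoints.\<close>
  let ?C = "{a..b} \<inter> g -` {..r}"
  have C: "closed ?C" by (rule continuous_closed_preimage[OF g]) auto
  have ae': "AE x \<in> {a<..<b} in lebesgue. x \<in> ?C"
    using ae by eventually_elim (auto simp: r)
  have "{a<..<b} \<subseteq> ?C" using mem_closed_if_AE_lebesgue_open[OF _ C ae'] by auto
  then have "closure {a<..<b} \<subseteq> ?C" using C closure_minimal by blast
  then have "g s \<le> r" using s True by auto
  then show ?thesis using True by (simp add: ess_sup_on_def r flip: E_def)
qed

lemma ess_sup_on_zero: "ess_sup_on a b (\<lambda>s. 0) = 0"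
proof (cases "a < b")
  case True
  then have "emeasure (lebesgue_on {a..b}) (space (lebesgue_on {a..b})) \<noteq> 0"
    by (simp add: emeasure_restrict_space)
  then show ?thesis using True esssup_const[of "lebesgue_on {a..b}" "0::ereal"]
    by (simp add: ess_sup_on_def zero_ereal_def)
qed (simp add: ess_sup_on_def)

section \<open>Output-input stability implies stable zeros\<close>

lemma nth_deriv_const_0: "t \<ge> 0 \<Longrightarrow> nth_deriv k (\<lambda>s. 0 :: 'a::real_normed_vector) t = 0"
proof (induction k arbitrary: t)
  case (Suc k)
  have "(nth_deriv k (\<lambda>s. 0 :: 'a) has_vector_derivative 0) (at t within {0..})"
    by (rule has_vector_derivative_transform[of _ _ _ "\<lambda>s. 0"]) (use Suc in auto)
  then show ?case by (rule nth_deriv_SucI[OF _ Suc.prems])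
qed (simp add: nth_deriv_0)

text \<open>\<open>L\<close> is any bounded real-linear map on the complex numbers, so that one
  formula covers the state Re (w z) and the input obtained from it by feedback.\<close>

lemma exp_mode_nth_deriv:
  assumes L: "bounded_linear (L :: complex \<Rightarrow> 'a::real_normed_vector)" and "t \<ge> 0"
  shows "nth_deriv k (\<lambda>s. L (c * exp (of_real s * \<mu>))) t = L (\<mu> ^ k * c * exp (of_real t * \<mu>))"
    and "(nth_deriv k (\<lambda>s. L (c * exp (of_real s * \<mu>))) has_vector_derivative
            L (\<mu> ^ Suc k * c * exp (of_real t * \<mu>))) (at t within {0..})"
proof -
  have der: "((\<lambda>s. L (d * exp (of_real s * \<mu>))) has_vector_derivative L (\<mu> * d * exp (of_real t * \<mu>)))
      (at t within {0..})" for d t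
    by (intro bounded_linear.has_vector_derivative[OF L]
        has_vector_derivative_real_field[where f = "\<lambda>z. d * exp (z * \<mu>)"])
       (auto intro!: derivative_eq_intros)
  have step: "(nth_deriv k (\<lambda>s. L (c * exp (of_real s * \<mu>))) has_vector_derivative
            L (\<mu> ^ Suc k * c * exp (of_real t * \<mu>))) (at t within {0..})"
    if "\<And>s. s \<ge> 0 \<Longrightarrow> nth_deriv k (\<lambda>s. L (c * exp (of_real s * \<mu>))) s = L (\<mu> ^ k * c * exp (of_real s * \<mu>))"
      "t \<ge> 0" for k t
    by (rule has_vector_derivative_transform[of _ _ _ "\<lambda>s. L (\<mu> ^ k * c * exp (of_real s * \<mu>))"])
       (use that der[of "\<mu> ^ k * c"] in \<open>auto simp: mult.assoc\<close>)
  have eq: "nth_deriv k (\<lambda>s. L (c * exp (of_real s * \<mu>))) t = L (\<mu> ^ k * c * exp (of_real t * \<mu>))"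
    if "t \<ge> 0" for t
    using that
  proof (induction k arbitrary: t)
    case (Suc k)
    then show ?case by (intro nth_deriv_SucI step) auto
  qed (simp add: nth_deriv_0)
  show "nth_deriv k (\<lambda>s. L (c * exp (of_real s * \<mu>))) t = L (\<mu> ^ k * c * exp (of_real t * \<mu>))"
    by (rule eq[OF \<open>t \<ge> 0\<close>])
  show "(nth_deriv k (\<lambda>s. L (c * exp (of_real s * \<mu>))) has_vector_derivative
            L (\<mu> ^ Suc k * c * exp (of_real t * \<mu>))) (at t within {0..})"
    by (rule step[OF eq \<open>t \<ge> 0\<close>])
qed

lemma cont_differentiable_exp_mode:
  assumes L: "bounded_linear (L :: complex \<Rightarrow> 'a::real_normed_vector)"
  shows "cont_differentiable n (\<lambda>s. L (c * exp (of_real s * \<mu>)))"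
  unfolding cont_differentiable_def
proof (intro conjI allI impI)
  fix j t assume "0 \<le> (t::real)"
  then show "nth_deriv j (\<lambda>s. L (c * exp (of_real s * \<mu>))) differentiable (at t within {0..})"
    using exp_mode_nth_deriv(2)[OF L] by (metis differentiableI_vector)
next
  show "continuous_on {0..} (nth_deriv n (\<lambda>s. L (c * exp (of_real s * \<mu>))))"
    unfolding continuous_on_eq_continuous_within
    using exp_mode_nth_deriv(2)[OF L] has_vector_derivative_continuous by (metis atLeast_iff)
qed

text \<open>An eigenvector \<open>z\<close> for a transmission zero \<open>\<mu>\<close> yields the trajectories \<open>Re (c e\<^sup>\<mu>\<^sup>t z)\<close>, whose
  output vanishes identically. Both \<open>c = 1\<close> and \<open>c = - \<i>\<close> are used, to control real and
  imaginary parts.\<close>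

lemma output_input_stable_imp_zeros:
  fixes A :: "real^'n^'n" and B :: "real^'m^'n" and C :: "real^'n^'l"
  assumes ois: "output_input_stable A B C" and \<mu>: "\<mu> \<in> transmission_zeros A B C"
  shows "Re \<mu> < 0"
proof (rule ccontr)
  assume "\<not> Re \<mu> < 0"
  define S where "S = max_AB_invariant_in_ker A B C"
  have S: "subspace S" "\<And>x. x \<in> S \<Longrightarrow> C *v x = 0"
    using max_AB_invariant_in_ker_greatest(1)[of A B C] by (auto simp: S_def AB_invariant_def)
  obtain F :: "real^'n^'m" and z where z: "z \<noteq> 0" "(\<chi> i. Re (z $ i)) \<in> S" "(\<chi> i. Im (z $ i)) \<in> S"
    "map_matrix complex_of_real (A + B ** F) *v z = \<mu> *s z"
    using \<mu> unfolding transmission_zeros_def restriction_eigenvalue_def S_def[symmetric] Let_def by blast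
  obtain N \<beta> \<gamma> where KL: "class_KL \<beta>" "class_K_inf \<gamma>"
    and est: "\<And>u x t. cont_differentiable (N - 1) u \<Longrightarrow> solves A B u x \<Longrightarrow> t \<ge> 0 \<Longrightarrow>
      norm (u t, x t) \<le> \<beta> (norm (x 0)) t + \<gamma> (ess_sup_on 0 t (jet_norm N (\<lambda>s. C *v x s)))"
    using ois unfolding output_input_stable_def by blast
  define L where "L w = (\<chi> i. Re (w * z $ i))" for w
  have L_eq: "L w = Re w *\<^sub>R (\<chi> i. Re (z $ i)) - Im w *\<^sub>R (\<chi> i. Im (z $ i))" for w
    by (simp add: L_def vec_eq_iff)
  have L: "bounded_linear L" unfolding L_eq
    by (intro bounded_linear_sub bounded_linear_scaleR_left[THEN bounded_linear_compose]
        bounded_linear_Re bounded_linear_Im)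
  have LS: "L w \<in> S" for w unfolding L_eq
    using S(1) z by (intro subspace_diff subspace_scale) auto
  \<comment> \<open>On the real vectors Re (w z), the closed loop acts as multiplication of
    \<open>w\<close> by \<open>\<mu>\<close>.\<close>
  have LM: "(A + B ** F) *v L w = L (\<mu> * w)" for w
  proof -
    have "Re (w * (map_matrix complex_of_real (A + B ** F) *v z) $ i) = ((A + B ** F) *v L w) $ i" for i
      by (simp add: L_def matrix_vector_mult_def sum_distrib_left mult.left_commute del: times_complex.sel)
         (simp add: algebra_simps)
    then show ?thesis unfolding z(4) by (simp add: L_def vec_eq_iff mult_ac del: times_complex.sel)
  qed
  have lim: "((\<lambda>t. L (c * exp (of_real t * \<mu>))) \<longlongrightarrow> 0) at_top" for c
  proof -
    let ?x = "\<lambda>t. L (c * exp (of_real t * \<mu>))"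
    have bF: "bounded_linear (\<lambda>w. F *v L w)"
      by (rule bounded_linear_compose[OF bounded_linear_matrix_vector_mult L])
    have sol: "solves A B (\<lambda>t. F *v ?x t) ?x"
      unfolding solves_def
    proof (intro allI impI)
      fix t :: real assume "0 \<le> t"
      have "L (\<mu> * c * exp (of_real t * \<mu>)) = A *v ?x t + B *v (F *v ?x t)"
        using LM[of "c * exp (of_real t * \<mu>)"]
        by (simp add: matrix_vector_mult_add_rdistrib matrix_vector_mul_assoc mult.assoc)
      then show "(?x has_vector_derivative A *v ?x t + B *v (F *v ?x t)) (at t within {0..})"
        using exp_mode_nth_deriv(2)[OF L \<open>0 \<le> t\<close>, of 0 c \<mu>] by (simp add: nth_deriv_0)
    qed
    have "norm (?x t) \<le> \<beta> (norm (?x 0)) t" if t: "t \<ge> 0" for t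
    proof -
      have "C *v ?x s = 0" for s using S(2)[OF LS] .
      then have jet: "jet_norm N (\<lambda>s. C *v ?x s) s = 0" if "s \<ge> 0" for s
        unfolding jet_norm_def using nth_deriv_const_0[OF that, where 'a=real] by (simp add: L2_set_def)
      \<comment> \<open>The jet is known to vanish at nonnegative times only, so the two functions
        are compared on {0..t} rather than equated.\<close>
      have "ess_sup_on 0 t (jet_norm N (\<lambda>s. C *v ?x s)) = ess_sup_on 0 t (\<lambda>s. 0)"
      proof (cases "0 < t")
        case True
        have "esssup (lebesgue_on {0..t}) (\<lambda>s. ereal (jet_norm N (\<lambda>s. C *v ?x s) s))
            = esssup (lebesgue_on {0..t}) (\<lambda>s. ereal 0)"
        proof (rule esssup_AE_cong)
          have "(\<lambda>s. ereal (jet_norm N (\<lambda>s. C *v ?x s) s)) \<in> borel_measurable (lebesgue_on {0..t})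
            \<longleftrightarrow> (\<lambda>s. ereal 0) \<in> borel_measurable (lebesgue_on {0..t})"
            by (rule measurable_cong) (simp add: jet)
          then show "(\<lambda>s. ereal (jet_norm N (\<lambda>s. C *v ?x s) s)) \<in> borel_measurable (lebesgue_on {0..t})"
            by simp
        qed (auto intro!: AE_I2 simp: jet)
        then show ?thesis using True by (simp add: ess_sup_on_def)
      qed (use t jet in \<open>simp add: ess_sup_on_def\<close>)
      then have "norm (F *v ?x t, ?x t) \<le> \<beta> (norm (?x 0)) t + \<gamma> 0"
        using est[OF cont_differentiable_exp_mode[OF bF] sol t] by (simp add: ess_sup_on_zero)
      moreover have "\<gamma> 0 = 0" using KL(2) by (simp add: class_K_inf_def class_K_def)
      moreover have "norm (?x t) \<le> norm (F *v ?x t, ?x t)" using norm_snd_le by metis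
      ultimately show ?thesis by linarith
    qed
    then have "\<forall>\<^sub>F t in at_top. norm (?x t) \<le> \<beta> (norm (?x 0)) t"
      by (intro eventually_mono[OF eventually_ge_at_top[of 0]])
    moreover have "(\<beta> (norm (?x 0)) \<longlongrightarrow> 0) at_top" using KL(1) by (simp add: class_KL_def)
    ultimately show ?thesis by (rule Lim_null_comparison)
  qed
  obtain i where i: "z $ i \<noteq> 0" using z(1) by (auto simp: vec_eq_iff)
  have Re0: "((\<lambda>t. Re (c * exp (of_real t * \<mu>) * z $ i)) \<longlongrightarrow> 0) at_top" for c
    using tendsto_vec_nth[OF lim[of c], of i] by (simp add: L_def)
  have "((\<lambda>t. exp (of_real t * \<mu>) * z $ i) \<longlongrightarrow> 0) at_top"
    unfolding tendsto_complex_iff using Re0[of 1] Re0[of "- \<i>"] by (simp add: algebra_simps)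
  then have "((\<lambda>t. norm (exp (of_real t * \<mu>) * z $ i)) \<longlongrightarrow> 0) at_top" by (rule tendsto_norm_zero)
  moreover have "\<forall>\<^sub>F t in at_top. norm (z $ i) \<le> norm (exp (of_real t * \<mu>) * z $ i)"
  proof (rule eventually_mono[OF eventually_ge_at_top[of 0]])
    fix t :: real assume "0 \<le> t"
    then have "1 \<le> exp (t * Re \<mu>)" using \<open>\<not> Re \<mu> < 0\<close> by simp
    then show "norm (z $ i) \<le> norm (exp (of_real t * \<mu>) * z $ i)"
      by (simp add: norm_mult mult_le_cancel_right1)
  qed
  ultimately have "norm (z $ i) \<le> 0"
    by (rule tendsto_lowerbound) simp
  then show False using i by simp
qed

section \<open>Stable zeros imply output-input stability\<close>

lemma of_real_matrix_mult:
  "map_matrix complex_of_real (A ** B) = map_matrix complex_of_real A ** map_matrix complex_of_real B"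
  by (simp add: vec_eq_iff matrix_matrix_mult_def)

lemma of_real_matrix_diff:
  "map_matrix complex_of_real (A - B) = map_matrix complex_of_real A - map_matrix complex_of_real B"
  by (simp add: vec_eq_iff)

lemma of_real_matrix_1: "map_matrix complex_of_real (mat 1) = mat 1"
  by (simp add: vec_eq_iff mat_def)

lemma Re_of_real_matrix_mult:
  "(\<chi> i. Re ((map_matrix complex_of_real A *v v) $ i)) = A *v (\<chi> i. Re (v $ i))"
  "(\<chi> i. Im ((map_matrix complex_of_real A *v v) $ i)) = A *v (\<chi> i. Im (v $ i))"
  by (simp_all add: vec_eq_iff matrix_vector_mult_def)

text \<open>Off the invariant subspace, on which \<open>M\<close> acts unchanged, the eigenvalue \<open>- 1\<close> is added.\<close>

lemma stabilised_complement_eigenvalue: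
  fixes M P :: "real^'n^'n"
  assumes P: "\<And>x. P *v x \<in> S" "\<And>x. x \<in> S \<Longrightarrow> P *v x = x" and M: "(*v) M ` S \<subseteq> S"
    and v: "v \<noteq> 0" "map_matrix complex_of_real (P ** M ** P - (mat 1 - P)) *v v = \<mu> *s v"
  shows "\<mu> = - 1 \<or> restriction_eigenvalue M S \<mu>"
proof -
  let ?c = "\<lambda>A. map_matrix complex_of_real (A :: real^'n^'n)"
  define G where "G = P ** M ** P - (mat 1 - P)"
  \<comment> \<open>From (1 - P) G = -(1 - P), the component (1 - P) v of an eigenvector is
    multiplied both by \<open>\<mu>\<close> and by -1. Hence \<open>\<mu> = - 1\<close> or that
    component is zero.\<close>
  have "((mat 1 - P) ** G) *v x = (0 - (mat 1 - P)) *v x" for x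
    using P by (simp add: G_def matrix_vector_mult_diff_rdistrib matrix_vector_mult_diff_distrib flip: matrix_vector_mul_assoc)
  then have "(mat 1 - P) ** G = 0 - (mat 1 - P)" by (simp add: matrix_eq)
  then have "?c (mat 1 - P) ** ?c G = ?c (0 - (mat 1 - P))" by (metis of_real_matrix_mult)
  also have "\<dots> = - ?c (mat 1 - P)" by (simp add: vec_eq_iff)
  finally have "?c (mat 1 - P) *v (?c G *v v) = (- ?c (mat 1 - P)) *v v"
    by (simp only: matrix_vector_mul_assoc)
  moreover have "?c (mat 1 - P) *v (?c G *v v) = \<mu> *s (?c (mat 1 - P) *v v)"
    using v(2) by (simp only: G_def vector_scalar_commute)
  moreover have "(- X) *v v = (- 1) *s (X *v v)" for X :: "complex^'n^'n"
    by (simp add: vec_eq_iff matrix_vector_mult_def sum_negf)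
  ultimately have "\<mu> *s (?c (mat 1 - P) *v v) = (- 1) *s (?c (mat 1 - P) *v v)"
    by (simp only:)
  then have "\<mu> = - 1 \<or> ?c (mat 1 - P) *v v = 0" by (simp only: vec.scale_cancel_right)
  moreover have "restriction_eigenvalue M S \<mu>" if "?c (mat 1 - P) *v v = 0"
  proof -
    have Pv: "?c P *v v = v"
      using that by (simp add: of_real_matrix_diff of_real_matrix_1 matrix_vector_mult_diff_rdistrib)
    have "(\<chi> i. Re (v $ i)) = P *v (\<chi> i. Re (v $ i))" "(\<chi> i. Im (v $ i)) = P *v (\<chi> i. Im (v $ i))"
      using Re_of_real_matrix_mult[of P v] Pv by simp_all
    then have S: "(\<chi> i. Re (v $ i)) \<in> S" "(\<chi> i. Im (v $ i)) \<in> S" using P(1) by metis+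
    have "(P ** M ** P) *v x = (M ** P) *v x" for x
      using P M by (auto simp flip: matrix_vector_mul_assoc)
    then have "P ** M ** P = M ** P" by (simp add: matrix_eq)
    then have "?c (P ** M ** P) *v v = ?c M *v v"
      by (simp add: of_real_matrix_mult Pv flip: matrix_vector_mul_assoc)
    moreover have "?c G *v v = ?c (P ** M ** P) *v v - ?c (mat 1 - P) *v v"
      by (simp add: G_def of_real_matrix_diff matrix_vector_mult_diff_rdistrib)
    ultimately have "?c M *v v = \<mu> *s v" using that v(2) by (simp add: G_def)
    then show ?thesis using v(1) S unfolding restriction_eigenvalue_def by blast
  qed
  ultimately show ?thesis by blast
qed

lemma class_KL_exp: "c > 0 \<Longrightarrow> a > 0 \<Longrightarrow> class_KL (\<lambda>s t. c * exp (- a * t) * s)"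
  unfolding class_KL_def class_K_def
proof (intro conjI allI impI)
  fix s :: real assume c: "c > 0" "a > 0" "0 \<le> s"
  show "antimono_on {0..} (\<lambda>t. c * exp (- a * t) * s)"
    using c by (intro monotone_onI mult_right_mono mult_left_mono) auto
  have "((\<lambda>t. exp (- (a * t))) \<longlongrightarrow> 0) at_top"
    using c by (intro filterlim_compose[OF exp_at_bot] filterlim_uminus_at_bot_at_top[THEN filterlim_compose]
        filterlim_tendsto_pos_mult_at_top[OF tendsto_const _ filterlim_ident])
  then show "((\<lambda>t. c * exp (- a * t) * s) \<longlongrightarrow> 0) at_top"
    using tendsto_mult[OF tendsto_mult[OF tendsto_const[of c]] tendsto_const[of s]] by fastforce
qed (auto intro!: continuous_intros strict_mono_onI mult_strict_left_mono)

lemma class_K_inf_linear: "c > 0 \<Longrightarrow> class_K_inf (\<lambda>r. c * r)"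
  unfolding class_K_inf_def class_K_def
proof (intro conjI notI)
  assume c: "c > 0" and "bounded ((*) c ` {0..})"
  then obtain M where M: "\<And>r. r \<ge> 0 \<Longrightarrow> \<bar>c * r\<bar> \<le> M" by (auto simp: bounded_real)
  have "M \<ge> 0" using M[of 0] by simp
  then show False using M[of "(M + 1) / c"] c by (simp add: field_simps)
qed (auto intro!: continuous_intros strict_mono_onI)

lemma zeros_imp_output_input_stable:
  fixes A :: "real^'n^'n" and B :: "real^'m^'n" and C :: "real^'n^'l"
  assumes li: "left_invertible A B C" and zeros: "\<And>\<mu>. \<mu> \<in> transmission_zeros A B C \<Longrightarrow> Re \<mu> < 0"
  shows "output_input_stable A B C"
proof -
  define S where "S = max_AB_invariant_in_ker A B C"
  obtain F :: "real^'n^'m" where S: "subspace S" and F: "(*v) (A + B ** F) ` S \<subseteq> S"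
    using max_AB_invariant_in_ker_greatest(1)[of A B C] by (auto simp: S_def AB_invariant_def)
  define M where "M = A + B ** F"
  obtain P :: "real^'n^'n" where P: "\<And>x. P *v x \<in> S" "\<And>x. x \<in> S \<Longrightarrow> P *v x = x"
    using subspace_projection[OF S] by blast
  define G where "G = P ** M ** P - (mat 1 - P)"
  have "Re \<mu> < 0" if "v \<noteq> 0" "map_matrix complex_of_real G *v v = \<mu> *s v" for \<mu> v
  proof -
    have "\<mu> = - 1 \<or> restriction_eigenvalue M S \<mu>"
      by (rule stabilised_complement_eigenvalue[OF P _ that[unfolded G_def]]) (use F M_def in auto)
    moreover have "\<mu> \<in> transmission_zeros A B C" if "restriction_eigenvalue M S \<mu>"
      using that F by (auto simp: transmission_zeros_def S_def M_def Let_def)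
    ultimately show ?thesis using zeros by auto
  qed
  then obtain K2 a where K2: "K2 \<ge> 0" "a > 0" and stable: "\<And>z d T D t.
    (\<And>t. t\<in>{0..T} \<Longrightarrow> (z has_vector_derivative (G *v z t + d t)) (at t within {0..T})) \<Longrightarrow>
    (\<And>t. t\<in>{0..T} \<Longrightarrow> norm (d t) \<le> D) \<Longrightarrow> t\<in>{0..T} \<Longrightarrow>
    norm (z t) \<le> K2 * (exp (- a * t) * norm (z 0) + D)"
    using hurwitz_solution_bound[of G] by metis
  obtain N K where N: "N \<ge> 1" and K: "K \<ge> 0" and rec:
    "\<And>X U. (\<And>j. j < N \<Longrightarrow> X (Suc j) = A *v X j + B *v U j) \<Longrightarrow>
       norm (X 0 - P *v X 0) \<le> K * (\<Sum>j\<le>N. norm (C *v X j)) \<and>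
       norm (U 0 - F *v X 0) \<le> K * (\<Sum>j\<le>N. norm (C *v X j))"
    by (rule state_input_bound[OF li F[unfolded S_def] P(2)[unfolded S_def]])
       (assumption, rule that, assumption, assumption, blast)
  obtain n where n: "N = Suc n" using N by (cases N) auto
  have bnd: "\<exists>b\<ge>0. \<forall>y. norm (Q *v y) \<le> b * norm y" for Q :: "real^'i^'j"
    using bounded_linear.nonneg_bounded[OF bounded_linear_matrix_vector_mult[of Q]]
    by (auto simp: mult.commute)
  obtain p where p: "p \<ge> 0" "\<And>y. norm (P *v y) \<le> p * norm y" using bnd by blast
  obtain f where f: "f \<ge> 0" "\<And>y. norm (F *v y) \<le> f * norm y" using bnd by blast
  obtain b1 where b1: "b1 \<ge> 0" "\<And>y. norm ((P ** M) *v y) \<le> b1 * norm y" using bnd by blast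
  obtain b2 where b2: "b2 \<ge> 0" "\<And>y. norm ((P ** B) *v y) \<le> b2 * norm y" using bnd by blast
  \<comment> \<open>Converts the jet bound by a sum of norms into one by \<open>jet_norm\<close>;
    \<open>Suc N\<close> counts the orders 0 to \<open>N\<close>.\<close>
  define c where "c = K * (real (Suc N) * real CARD('l))"
  have c: "c \<ge> 0" using K by (simp add: c_def)
  \<comment> \<open>\<open>\<kappa>\<close> and \<open>\<alpha>\<close> are the coefficients of
    \<open>E\<close> and of exp(-a t) |x(0)| when the bound on \<open>x t\<close> is inserted into
    |(u, x)| \<le> (1 + f) |x| + D.\<close>
  define \<kappa> where "\<kappa> = c * (1 + (1 + f) * (1 + K2 * (b1 + b2)))"
  define \<alpha> where "\<alpha> = (1 + f) * K2 * p"
  have \<kappa>: "\<kappa> \<ge> 0" unfolding \<kappa>_def using c f K2 b1 b2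
    by (intro mult_nonneg_nonneg add_nonneg_nonneg) auto
  have \<alpha>: "\<alpha> \<ge> 0" unfolding \<alpha>_def using f K2 p by (intro mult_nonneg_nonneg add_nonneg_nonneg) auto
  have est: "norm (u t, x t) \<le> (\<alpha> + 1) * exp (- a * t) * norm (x 0)
      + (\<kappa> + 1) * ess_sup_on 0 t (jet_norm N (\<lambda>s. C *v x s))"
    if u: "cont_differentiable (N - 1) u" and x: "solves A B u x" and t: "t \<ge> 0" for u x t
  proof -
    have u: "cont_differentiable n u" using u n by simp
    let ?J = "jet_norm N (\<lambda>s. C *v x s)"
    define E where "E = ess_sup_on 0 t ?J"
    have J: "?J s \<le> E" if "s \<in> {0..t}" for s unfolding E_def
      by (rule le_ess_sup_on[OF _ that], rule continuous_on_subset[of "{0..}"])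
         (use continuous_on_jet_norm_output[OF x u] n in auto)
    have "0 \<le> ?J 0" by (simp add: jet_norm_def)
    then have E: "E \<ge> 0" using J[of 0] t by auto
    define D where "D = c * E"
    have D: "D \<ge> 0" using c E by (simp add: D_def)
    define v where "v s = u s - F *v x s" for s
    define w where "w s = x s - P *v x s" for s
    have vw: "norm (w s) \<le> D \<and> norm (v s) \<le> D" if s: "s \<in> {0..t}" for s
    proof -
      let ?Y = "\<Sum>j\<le>N. norm (C *v nth_deriv j x s)"
      have "nth_deriv (Suc j) x s = A *v nth_deriv j x s + B *v nth_deriv j u s" if "j < N" for j
        by (rule nth_deriv_SucI[OF state_nth_deriv[OF x u]]) (use that n s in auto)
      then have "norm (w s) \<le> K * ?Y \<and> norm (v s) \<le> K * ?Y"
        using rec[of "\<lambda>j. nth_deriv j x s" "\<lambda>j. nth_deriv j u s"] by (simp add: nth_deriv_0 w_def v_def)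
      moreover have "?Y \<le> real (Suc N) * real CARD('l) * ?J s"
        using sum_norm_output_le_jet_norm[OF x u, of s C] s by (simp only: n) auto
      then have "?Y \<le> real (Suc N) * real CARD('l) * E"
        using J[OF s] by (smt (verit) mult_left_mono of_nat_0_le_iff mult_nonneg_nonneg)
      then have "K * ?Y \<le> D"
        unfolding D_def c_def mult.assoc using K by (intro mult_left_mono) (simp_all add: mult.assoc)
      ultimately show ?thesis by linarith
    qed
    have s_bound: "norm (P *v x t) \<le> K2 * (exp (- a * t) * norm (P *v x 0) + (b1 + b2) * D)"
    proof (rule stable[where z = "\<lambda>s. P *v x s" and T = t and d = "\<lambda>s. (P ** M) *v w s + (P ** B) *v v s"])
      fix s assume s: "s \<in> {0..t}"
      have "(x has_vector_derivative A *v x s + B *v u s) (at s within {0..})"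
        using x s by (simp add: solves_def)
      then have "(x has_vector_derivative A *v x s + B *v u s) (at s within {0..t})"
        by (rule has_vector_derivative_within_subset) auto
      then have "((\<lambda>s. P *v x s) has_vector_derivative P *v (A *v x s + B *v u s)) (at s within {0..t})"
        by (rule has_vector_derivative_matrix_vector_mult)
      \<comment> \<open>Insert u = F x + v and x = P x + w. On the range of \<open>P\<close> the
        term 1 - P of \<open>G\<close> vanishes, so \<open>G\<close> contributes PM(P x), and the
        rest is forcing.\<close>
      moreover have "P *v (A *v x s + B *v u s) = G *v (P *v x s) + ((P ** M) *v w s + (P ** B) *v v s)"
      proof -
        have "P *v (P *v x s) = P *v x s" using P by simp
        moreover have "A *v x s + B *v u s = M *v x s + B *v v s"
          by (simp add: M_def v_def matrix_vector_mult_add_rdistrib matrix_vector_mult_diff_distrib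
              matrix_vector_mul_assoc)
        ultimately show ?thesis
          by (simp add: G_def w_def matrix_vector_mult_diff_rdistrib matrix_vector_mult_diff_distrib
              matrix_vector_right_distrib flip: matrix_vector_mul_assoc)
      qed
      ultimately show "((\<lambda>s. P *v x s) has_vector_derivative
          G *v (P *v x s) + ((P ** M) *v w s + (P ** B) *v v s)) (at s within {0..t})" by simp
      have "norm ((P ** M) *v w s) \<le> b1 * D" "norm ((P ** B) *v v s) \<le> b2 * D"
        using vw[OF s] b1 b2 by (meson mult_left_mono order_trans)+
      then show "norm ((P ** M) *v w s + (P ** B) *v v s) \<le> (b1 + b2) * D"
        using norm_triangle_ineq[of "(P ** M) *v w s" "(P ** B) *v v s"] by (simp add: algebra_simps)
    qed (use t in auto)
    also have "\<dots> \<le> K2 * (exp (- a * t) * (p * norm (x 0)) + (b1 + b2) * D)"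
      using K2 p by (intro mult_left_mono add_right_mono) auto
    finally have "norm (P *v x t) \<le> K2 * (exp (- a * t) * (p * norm (x 0)) + (b1 + b2) * D)" .
    moreover have "norm (x t) \<le> norm (P *v x t) + D"
      using norm_triangle_ineq[of "P *v x t" "w t"] vw[of t] t by (simp add: w_def)
    ultimately have xt: "norm (x t) \<le> K2 * (exp (- a * t) * (p * norm (x 0)) + (b1 + b2) * D) + D" by linarith
    have "norm (u t) \<le> norm (F *v x t) + norm (v t)"
      using norm_triangle_ineq[of "F *v x t" "v t"] by (simp add: v_def)
    then have "norm (u t) \<le> f * norm (x t) + D" using f(2)[of "x t"] vw[of t] t by simp
    then have "norm (u t, x t) \<le> (1 + f) * norm (x t) + D"
      using norm_Pair_le[of "u t" "x t"] by (simp add: algebra_simps)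
    also have "\<dots> \<le> (1 + f) * (K2 * (exp (- a * t) * (p * norm (x 0)) + (b1 + b2) * D) + D) + D"
      using xt f(1) by (intro add_right_mono mult_left_mono) auto
    also have "\<dots> = \<alpha> * exp (- a * t) * norm (x 0) + \<kappa> * E"
      by (simp only: \<alpha>_def \<kappa>_def D_def) (simp add: algebra_simps)
    \<comment> \<open>The added 1 makes both coefficients positive, as strict monotonicity of the
      comparison functions requires.\<close>
    also have "\<dots> \<le> (\<alpha> + 1) * exp (- a * t) * norm (x 0) + (\<kappa> + 1) * E"
      using E by (intro add_mono mult_right_mono) auto
    finally show ?thesis by (simp only: E_def)
  qed
  show ?thesis
    unfolding output_input_stable_def
  proof (intro exI conjI allI impI)
    show "class_KL (\<lambda>s t. (\<alpha> + 1) * exp (- a * t) * s)" by (rule class_KL_exp) (use \<alpha> K2 in auto)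
    show "class_K_inf (\<lambda>r. (\<kappa> + 1) * r)" by (rule class_K_inf_linear) (use \<kappa> in auto)
  qed (use N est in auto)
qed

theorem theorem2:
  fixes A :: "real^'n^'n" and B :: "real^'m^'n" and C :: "real^'n^'l"
  assumes "left_invertible A B C"
  shows "output_input_stable A B C \<longleftrightarrow> (\<forall>\<mu>\<in>transmission_zeros A B C. Re \<mu> < 0)"
  using output_input_stable_imp_zeros zeros_imp_output_input_stable[OF assms] by blast

end
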